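(* Let $\beta>0$ and let $p,q$ be multi-indices with $d=\deg(p)=\deg(q)$. Then $$\sum_{\mathbf m} C(p,q,\mathbf m)\prod_{N} \frac{\mathbf m(N)!}{(N\beta+1)(N\beta+2)\cdots(N\beta+\mathbf m(N))}=E_{\mathcal P_d}\left( f(p,L)f(q,L)\beta^{-|L|}\right),$$ where the sum on the left is over all multi-indices $\mathbf m=(\mathbf m(0),\mathbf m(1),\dots)$ with indexing starting at $0$, and the right-hand side is a polynomial of degree $d$ in $\beta^{-1}$.
   Context: A multi-index is a sequence $p=(p(1),p(2),\dots)$ of non-negative integers with only finitely many nonzero entries; $\deg(p)=\sum_j j\,p(j)$, $|p|=\sum_j p(j)$, $p!=\prod_j p(j)!$. The multi-index $\mathbf m=(\mathbf m(0),\mathbf m(1),\dots)$ is of the same kind except that its indexing starts at $0$. Definition of $C(p,q,\mathbf m)$. For a function $i$ on a finite domain with values in the non-negative integers, let $\delta_i$ denote the density of the image: $\delta_i(N)$ is the number of points of the domain mapped to $N$, $N\ge 0$. Then $C(p,q,\mathbf m)$ is the number of tuples $(i_{n,r},j_{n,r},k_{m,s},l_{m,s})$ of finite integer sequences satisfying: (1) the indices range over $n,m\ge 1$, $1\le r\le p(n)$, $1\le s\le q(m)$; (2) for each $(n,r)$ the sequences $i_{n,r},j_{n,r}$ have a common length and $i_{n,r}(1)>j_{n,r}(1)>i_{n,r}(2)>\cdots>j_{n,r}(\mathrm{length}(j_{n,r}))\ge 0$ with $\sum_u (i_{n,r}(u)-j_{n,r}(u))=n$; and for each $(m,s)$ the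 sequences $k_{m,s},l_{m,s}$ have a common length and $k_{m,s}(1)>l_{m,s}(1)>k_{m,s}(2)>\cdots>l_{m,s}(\mathrm{length}(l_{m,s}))\ge 0$ with $\sum_v (k_{m,s}(v)-l_{m,s}(v))=m$; (3) $\mathbf m=\sum_{n,r}\delta_{i_{n,r}}+\sum_{m,s}\delta_{l_{m,s}} = \sum_{n,r}\delta_{j_{n,r}}+\sum_{m,s}\delta_{k_{m,s}}$. Definition of the right-hand side. $\mathcal P_d$ is the set of partitions of $d$, where a partition is identified with its density, i.e. with a multi-index $L$ of degree $d$ ($L(u)$ is the number of parts equal to $u$). $E_{\mathcal P_d}$ is expectation with respect to the probability measure on $\mathcal P_d$ that is the pushforward of the normalized counting (Haar) measure of the symmetric group $S_d$ under the map sending a permutation to its cycle type; explicitly $L$ has probability $\prod_u \frac{1}{L(u)!\,u^{L(u)}}$. The function $f(p,\cdot):\mathcal P_d\to\{0,1,\dots\}$ is $$f(p,L)= \sum_{(J_{n,r})}\ \prod_{u}\frac{L(u)!}{\prod_{n,r}J_{n,r}(u)!},$$ the sum being over all families of multi-indices $(J_{n,r})_{n\ge1,\,1\le r\le p(n)}$ with $\deg(J_{n,r})=n$ and $\sum_{n,r}J_{n,r}=L$; $f(p,L)=0$ if there is no such family. *)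

theory Defs
  imports
    "HOL-Probability.Probability"
    "HOL-Combinatorics.Permutations"
    "HOL-Combinatorics.Orbits"
    "HOL-Computational_Algebra.Polynomial"
begin

(* A multi-index (p(1), p(2), ...) is a finitely supported function on the naturals whose
   unused value at 0 is normalised to 0, so that distinct functions are distinct multi-indices. *)
definition multi_index :: "(nat \<Rightarrow> nat) \<Rightarrow> bool" where
  "multi_index p \<longleftrightarrow> p 0 = 0 \<and> finite {j. p j \<noteq> 0}"

definition multi_index0 :: "(nat \<Rightarrow> nat) \<Rightarrow> bool" where
  "multi_index0 m \<longleftrightarrow> finite {N. m N \<noteq> 0}"

definition mi_deg :: "(nat \<Rightarrow> nat) \<Rightarrow> nat" where
  "mi_deg p = (\<Sum>j | p j \<noteq> 0. j * p j)"

definition mi_size :: "(nat \<Rightarrow> nat) \<Rightarrow> nat" where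
  "mi_size p = (\<Sum>j | p j \<noteq> 0. p j)"

definition idx :: "(nat \<Rightarrow> nat) \<Rightarrow> (nat \<times> nat) set" where
  "idx p = (SIGMA n:{1..}. {1..p n})"

(* a(1) > b(1) > a(2) > ... > b(length b) >= 0 with total difference n; positions are shifted to
   start at 0, and the subtraction of naturals is exact because b ! u < a ! u. *)
definition interlaced :: "nat \<Rightarrow> nat list \<Rightarrow> nat list \<Rightarrow> bool" where
  "interlaced n a b \<longleftrightarrow>
     length a = length b \<and>
     (\<forall>u<length a. a ! u > b ! u) \<and>
     (\<forall>u. Suc u < length a \<longrightarrow> b ! u > a ! Suc u) \<and>
     (\<Sum>u<length a. a ! u - b ! u) = n"

(* The density of a finite sequence xs is count_list xs.  Families indexed by idx p are taken
   extensional so that each family is counted exactly once. *)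
definition C_tuples ::
  "(nat \<Rightarrow> nat) \<Rightarrow> (nat \<Rightarrow> nat) \<Rightarrow> (nat \<Rightarrow> nat) \<Rightarrow>
   ((nat \<times> nat \<Rightarrow> nat list) \<times> (nat \<times> nat \<Rightarrow> nat list) \<times>
    (nat \<times> nat \<Rightarrow> nat list) \<times> (nat \<times> nat \<Rightarrow> nat list)) set" where
  "C_tuples p q m =
     {(i, j, k, l).
        i \<in> extensional (idx p) \<and> j \<in> extensional (idx p) \<and>
        k \<in> extensional (idx q) \<and> l \<in> extensional (idx q) \<and>
        (\<forall>(n, r)\<in>idx p. interlaced n (i (n, r)) (j (n, r))) \<and>
        (\<forall>(n, s)\<in>idx q. interlaced n (k (n, s)) (l (n, s))) \<and>
        m = (\<lambda>N. (\<Sum>x\<in>idx p. count_list (i x) N) + (\<Sum>y\<in>idx q. count_list (l y) N)) \<and>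
        m = (\<lambda>N. (\<Sum>x\<in>idx p. count_list (j x) N) + (\<Sum>y\<in>idx q. count_list (k y) N))}"

definition C_count :: "(nat \<Rightarrow> nat) \<Rightarrow> (nat \<Rightarrow> nat) \<Rightarrow> (nat \<Rightarrow> nat) \<Rightarrow> nat" where
  "C_count p q m = card (C_tuples p q m)"

(* The number of cycles of each length; fixed points are cycles of length 1. *)
definition cycle_type :: "nat \<Rightarrow> (nat \<Rightarrow> nat) \<Rightarrow> (nat \<Rightarrow> nat)" where
  "cycle_type d \<pi> = (\<lambda>u. card {X \<in> orbit \<pi> ` {1..d}. card X = u})"

definition partition_pmf :: "nat \<Rightarrow> (nat \<Rightarrow> nat) pmf" where
  "partition_pmf d = map_pmf (cycle_type d) (pmf_of_set {\<pi>. \<pi> permutes {1..d}})"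

definition f_families :: "(nat \<Rightarrow> nat) \<Rightarrow> (nat \<Rightarrow> nat) \<Rightarrow> (nat \<times> nat \<Rightarrow> nat \<Rightarrow> nat) set" where
  "f_families p L =
     {J \<in> (\<Pi>\<^sub>E (n, r)\<in>idx p. {J'. multi_index J' \<and> mi_deg J' = n}).
        (\<lambda>u. \<Sum>x\<in>idx p. J x u) = L}"

(* Factors with L u = 0 are equal to 1, since then every J x u is 0. *)
definition mi_f :: "(nat \<Rightarrow> nat) \<Rightarrow> (nat \<Rightarrow> nat) \<Rightarrow> real" where
  "mi_f p L = (\<Sum>J\<in>f_families p L.
              \<Prod>u | L u \<noteq> 0. fact (L u) / (\<Prod>x\<in>idx p. fact (J x u)))"

end

theory Submission
  imports Defs "HOL-Library.Poly_Mapping" "HOL-Library.Product_Plus"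
begin

text \<open>
  The factor \<open>m! / ((N\<beta>+1)\<cdots>(N\<beta>+m))\<close> is the moment \<open>E \<bar>\<alpha>\<^sub>N\<bar>^(2m)\<close> of a rotation invariant variable
  \<open>\<alpha>\<^sub>N\<close> on the unit disc with weight \<open>(1 - \<bar>\<alpha>\<bar>\<^sup>2)^(N\<beta>-1)\<close>, and the words \<open>(i, j)\<close> of weight \<open>n\<close> enumerate the
  coefficient of \<open>z^n\<close> in the corner entry \<open>A\<^sub>M(z)\<close> of a product of Szego transfer matrices
  \<open>(A, D) \<mapsto> (A + \<alpha> D, z (\<alpha>' A + D))\<close>, where \<open>\<alpha>'\<close> is the conjugate of \<open>\<alpha>\<close>. So the left-hand side is
  the limit of \<open>E (\<Prod> [z^n] A\<^sub>M \<cdot> \<Prod> [z^m] A'\<^sub>M)\<close>. The variables \<open>\<alpha>\<close>, \<open>\<alpha>'\<close> are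
  treated as formal commuting variables, and \<open>E\<close> as a linear functional on polynomials in them.

  There is a polynomial vector field \<open>X\<close> in the \<open>\<alpha>\<close>, \<open>\<alpha>'\<close>, a generating function in \<open>w\<close> of Ablowitz--Ladik flows,
  that annihilates \<open>A\<^sub>M(z)\<close>, maps \<open>A'\<^sub>M(z)\<close> to \<open>(D\<^sub>M(w) D'\<^sub>M(z) - w z A\<^sub>M(w) A'\<^sub>M(z)) / (1 - w z)\<close>,
  and satisfies \<open>E (X F) = - \<beta> E (w (dA\<^sub>M/dw) F)\<close>. Hence one has, for every finite \<open>M\<close>,
  a recursion for the correlations with an error term that is a correlation of the \<open>D\<close>. The error is nonnegative
  and, divided by \<open>M\<beta>+1\<close>, bounded by the increment of a convergent sequence; by divergence of the
  harmonic series it tends to \<open>0\<close>. The limiting recursion is the one satisfied by the scalar products of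
  products of complete homogeneous symmetric functions when \<open>\<langle>p\<^sub>L, p\<^sub>L\<rangle> = \<beta>^(-\<bar>L\<bar>) \<Prod> L(u)! u^L(u)\<close>, because
  \<open>n h\<^sub>n = \<Sum> p\<^sub>t h\<^sub>n\<^sub>-\<^sub>t\<close> and \<open>p\<^sub>t\<close> is adjoint to \<open>(t/\<beta>) d/dp\<^sub>t\<close>. These scalar products are the right-hand side.
\<close>

section \<open>A moment functional on polynomials\<close>

text \<open>A monomial is a pair of multisets of levels: the first lists the \<alpha>_N that occur
  in it, the second the conjugates.\<close>

type_synonym mpol = "(nat multiset \<times> nat multiset) \<Rightarrow>\<^sub>0 real"

text \<open>Moments of r for the density s (1 - r)^(s-1) on the unit interval; at s = 0 they are
  those of the unit mass at r = 1.\<close>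

definition mom :: "real \<Rightarrow> nat \<Rightarrow> real" where
  "mom s k = fact k / (\<Prod>i=1..k. s + real i)"

text \<open>Levels are independent and rotation invariant: a monomial survives only if each
  \<alpha>_N occurs as often as its conjugate, and then the moments multiply.\<close>

definition mono_wt :: "real \<Rightarrow> nat multiset \<times> nat multiset \<Rightarrow> real" where
  "mono_wt \<beta> ab = (if fst ab = snd ab
     then \<Prod>N\<in>set_mset (fst ab). mom (real N * \<beta>) (count (fst ab) N) else 0)"

definition expct :: "real \<Rightarrow> mpol \<Rightarrow> real" where
  "expct \<beta> F = (\<Sum>k\<in>Poly_Mapping.keys F. Poly_Mapping.lookup F k * mono_wt \<beta> k)"

definition mpmono :: "nat multiset \<times> nat multiset \<Rightarrow> mpol" where
  "mpmono k = Poly_Mapping.single k 1"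

definition varX :: "nat \<Rightarrow> mpol" where "varX n = mpmono ({#n#}, {#})"
definition varY :: "nat \<Rightarrow> mpol" where "varY n = mpmono ({#}, {#n#})"

lemma mom_0 [simp]: "mom s 0 = 1"
  by (simp add: mom_def)

lemma mom_nonneg: "s \<ge> 0 \<Longrightarrow> mom s k \<ge> 0"
  by (auto simp: mom_def intro!: divide_nonneg_nonneg prod_nonneg)

lemma mom_zero [simp]: "mom 0 k = 1"
  by (simp add: mom_def fact_prod of_nat_prod)

lemma mom_Suc: "s \<ge> 0 \<Longrightarrow> mom s (Suc k) * (s + real (Suc k)) = real (Suc k) * mom s k"
proof -
  assume s: "s \<ge> 0"
  have "s + real (Suc k) \<noteq> 0" using s by (simp add: add_nonneg_eq_0_iff)
  moreover have "(\<Prod>i=1..k. s + real i) \<noteq> 0" using s by (auto simp: add_nonneg_eq_0_iff)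
  ultimately show ?thesis
    by (simp add: mom_def prod.nat_ivl_Suc' del: of_nat_Suc)
qed

lemma mono_wt_nonneg: "\<beta> \<ge> 0 \<Longrightarrow> mono_wt \<beta> k \<ge> 0"
  by (auto simp: mono_wt_def intro!: prod_nonneg mom_nonneg)

lemma expct_superset:
  assumes "finite S" "Poly_Mapping.keys F \<subseteq> S"
  shows "expct \<beta> F = (\<Sum>k\<in>S. Poly_Mapping.lookup F k * mono_wt \<beta> k)"
  unfolding expct_def
  by (rule sum.mono_neutral_left) (use assms in \<open>auto simp: in_keys_iff\<close>)

lemma expct_add: "expct \<beta> (F + G) = expct \<beta> F + expct \<beta> G"
proof -
  let ?S = "Poly_Mapping.keys F \<union> Poly_Mapping.keys G"
  have "expct \<beta> (F + G) = (\<Sum>k\<in>?S. Poly_Mapping.lookup (F + G) k * mono_wt \<beta> k)"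
    by (rule expct_superset) (auto simp: keys_add)
  also have "\<dots> = (\<Sum>k\<in>?S. Poly_Mapping.lookup F k * mono_wt \<beta> k) +
      (\<Sum>k\<in>?S. Poly_Mapping.lookup G k * mono_wt \<beta> k)"
    by (simp add: lookup_add distrib_right sum.distrib)
  also have "\<dots> = expct \<beta> F + expct \<beta> G"
    by (simp add: expct_superset[of ?S])
  finally show ?thesis .
qed

lemma expct_0 [simp]: "expct \<beta> 0 = 0"
  by (simp add: expct_def)

lemma expct_uminus: "expct \<beta> (- F) = - expct \<beta> F"
  using expct_add[of \<beta> F "- F"] by simp

lemma expct_diff: "expct \<beta> (F - G) = expct \<beta> F - expct \<beta> G"
  using expct_add[of \<beta> F "- G"] by (simp add: expct_uminus)

lemma expct_sum: "expct \<beta> (sum f S) = (\<Sum>x\<in>S. expct \<beta> (f x))"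
  by (induction S rule: infinite_finite_induct) (auto simp: expct_add)

lemma expct_single: "expct \<beta> (Poly_Mapping.single k c) = c * mono_wt \<beta> k"
  by (auto simp: expct_def)

lemma expct_mpmono: "expct \<beta> (mpmono k) = mono_wt \<beta> k"
  by (simp add: mpmono_def expct_single)

lemma expct_of_nat_mult: "expct \<beta> (of_nat n * F) = real n * expct \<beta> F"
  by (induction n) (auto simp: expct_add algebra_simps)

lemma mpmono_mult: "mpmono k * mpmono l = mpmono (k + l)"
  by (simp add: mpmono_def mult_single)

lemma mpmono_0: "mpmono ({#}, {#}) = 1"
  by (simp add: mpmono_def zero_prod_def[symmetric])

lemma prod_mpmono: "(\<Prod>x\<in>S. mpmono (f x)) = mpmono (\<Sum>x\<in>S. f x)"
  by (induction S rule: infinite_finite_induct) (auto simp: mpmono_mult mpmono_0 zero_prod_def)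

lemma mpol_sum_single: "F = (\<Sum>k\<in>Poly_Mapping.keys F. Poly_Mapping.single k (Poly_Mapping.lookup F k))"
proof (rule poly_mapping_eqI)
  fix k
  show "Poly_Mapping.lookup F k = Poly_Mapping.lookup
    (\<Sum>k\<in>Poly_Mapping.keys F. Poly_Mapping.single k (Poly_Mapping.lookup F k)) k"
    by (simp add: lookup_sum lookup_single when_def in_keys_iff)
qed

lemma mpmono_power_X: "varX n ^ a = mpmono (replicate_mset a n, {#})"
  by (induction a) (auto simp: varX_def mpmono_mult mpmono_0)

lemma mpmono_power_Y: "varY n ^ a = mpmono ({#}, replicate_mset a n)"
  by (induction a) (auto simp: varY_def mpmono_mult mpmono_0)

section \<open>Independence of the levels\<close>

definition free :: "nat \<Rightarrow> mpol \<Rightarrow> bool" where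
  "free n F \<longleftrightarrow> (\<forall>(a, b)\<in>Poly_Mapping.keys F. n \<notin># a \<and> n \<notin># b)"

lemma free_add: "free n F \<Longrightarrow> free n G \<Longrightarrow> free n (F + G)"
  using keys_add[of F G] unfolding free_def by fast

lemma free_0 [simp]: "free n 0" and free_1 [simp]: "free n 1"
  by (auto simp: free_def zero_prod_def)

lemma free_mult: "free n F \<Longrightarrow> free n G \<Longrightarrow> free n (F * G)"
  using keys_mult[of F G] unfolding free_def by fastforce

lemma free_sum: "(\<And>x. x \<in> S \<Longrightarrow> free n (f x)) \<Longrightarrow> free n (sum f S)"
  by (induction S rule: infinite_finite_induct) (auto intro: free_add)

lemma free_prod: "(\<And>x. x \<in> S \<Longrightarrow> free n (f x)) \<Longrightarrow> free n (prod f S)"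
  by (induction S rule: infinite_finite_induct) (auto intro: free_mult)

lemma free_varX: "n \<noteq> k \<Longrightarrow> free n (varX k)" and free_varY: "n \<noteq> k \<Longrightarrow> free n (varY k)"
  by (auto simp: free_def varX_def varY_def mpmono_def)

definition mom2 :: "real \<Rightarrow> nat \<Rightarrow> nat \<Rightarrow> real" where
  "mom2 s a b = (if a = b then mom s a else 0)"

text \<open>Level n is absent from \<open>ab\<close>, so the balance condition splits into balance
  away from n and \<open>a = b\<close>, and the product of moments splits accordingly.\<close>

lemma mono_wt_add_replicate:
  assumes "n \<notin># fst ab" "n \<notin># snd ab"
  shows "mono_wt \<beta> (ab + (replicate_mset a n, replicate_mset b n)) =
    mono_wt \<beta> ab * mom2 (real n * \<beta>) a b"
proof -
  obtain u v where ab: "ab = (u, v)" by force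
  have uv: "count u n = 0" "count v n = 0"
    using assms by (auto simp: ab not_in_iff)
  have eq: "u + replicate_mset a n = v + replicate_mset b n \<longleftrightarrow> u = v \<and> a = b"
  proof
    assume *: "u + replicate_mset a n = v + replicate_mset b n"
    have "count (u + replicate_mset a n) n = count (v + replicate_mset b n) n"
      by (simp only: *)
    hence "a = b" using uv by simp
    thus "u = v \<and> a = b" using * by simp
  qed auto
  have "(\<Prod>N\<in>set_mset (u + replicate_mset a n). mom (real N * \<beta>) (count (u + replicate_mset a n) N))
      = (\<Prod>N\<in>insert n (set_mset u). mom (real N * \<beta>) (count (u + replicate_mset a n) N))"
    by (rule prod.mono_neutral_left) (auto simp: uv not_in_iff)
  also have "\<dots> = mom (real n * \<beta>) a * (\<Prod>N\<in>set_mset u. mom (real N * \<beta>) (count (u + replicate_mset a n) N))"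
    using assms by (simp add: ab uv)
  also have "(\<Prod>N\<in>set_mset u. mom (real N * \<beta>) (count (u + replicate_mset a n) N)) =
     (\<Prod>N\<in>set_mset u. mom (real N * \<beta>) (count u N))"
    using assms by (intro prod.cong) (auto simp: ab)
  finally show ?thesis
    by (auto simp: ab mono_wt_def mom2_def eq)
qed

lemma expct_free_power:
  assumes "free n g"
  shows "expct \<beta> (g * varX n ^ a * varY n ^ b) = expct \<beta> g * mom2 (real n * \<beta>) a b"
proof -
  let ?r = "(replicate_mset a n, replicate_mset b n)"
  have "g * varX n ^ a * varY n ^ b = g * mpmono ?r"
    by (simp add: mpmono_power_X mpmono_power_Y mpmono_mult mult.assoc)
  also have "\<dots> = (\<Sum>k\<in>Poly_Mapping.keys g. Poly_Mapping.single k (Poly_Mapping.lookup g k)) * mpmono ?r"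
    using mpol_sum_single[of g] by simp
  also have "\<dots> = (\<Sum>k\<in>Poly_Mapping.keys g. Poly_Mapping.single (k + ?r) (Poly_Mapping.lookup g k))"
    by (simp add: sum_distrib_right mpmono_def mult_single)
  finally have "expct \<beta> (g * varX n ^ a * varY n ^ b) =
      (\<Sum>k\<in>Poly_Mapping.keys g. Poly_Mapping.lookup g k * mono_wt \<beta> (k + ?r))"
    by (simp add: expct_sum expct_single)
  also have "\<dots> = (\<Sum>k\<in>Poly_Mapping.keys g. Poly_Mapping.lookup g k * mono_wt \<beta> k) * mom2 (real n * \<beta>) a b"
    unfolding sum_distrib_right
    proof (rule sum.cong)
    fix k assume "k \<in> Poly_Mapping.keys g"
    hence "n \<notin># fst k" "n \<notin># snd k"
      using assms by (cases k; force simp: free_def)+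
    thus "Poly_Mapping.lookup g k * mono_wt \<beta> (k + ?r) =
        Poly_Mapping.lookup g k * mono_wt \<beta> k * mom2 (real n * \<beta>) a b"
      by (simp add: mono_wt_add_replicate)
  qed simp
  finally show ?thesis by (simp add: expct_def)
qed

text \<open>Integration by parts against the density \<open>s * (1 - r) powr (s - 1)\<close> of \<open>\<bar>\<alpha>\<bar>\<^sup>2\<close>.\<close>

lemma mom2_parts:
  assumes "s \<ge> 0"
  shows "s * mom2 s (Suc a) b = real b * (mom2 s a (b - 1) - mom2 s (Suc a) b)"
proof (cases "b = Suc a")
  case True
  thus ?thesis using mom_Suc[OF assms, of a] by (simp add: mom2_def algebra_simps)
next
  case False
  thus ?thesis by (cases b) (auto simp: mom2_def)
qed

text \<open>In analytic terms, s E(x F) = E((1 - x y) dF/dy) for F = g x^a y^b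
  \<open>prod f S\<close>, with \<open>W i\<close> the y-derivative of \<open>f i\<close>. The
  induction absorbs the three terms of one affine factor into g, a and b, which is why general
  exponents are carried along. The letters x and y stay abstract so that a variable and its
  conjugate can exchange roles.\<close>

lemma expct_parts:
  fixes x y :: mpol
  assumes xy: "\<And>g a b. free n g \<Longrightarrow> expct \<beta> (g * x ^ a * y ^ b) = expct \<beta> g * mom2 s a b"
    and s: "s \<ge> 0" and fin: "finite S"
    and f: "\<And>i. i \<in> S \<Longrightarrow> f i = U i + x * V i + y * W i"
    and free: "\<And>i. i \<in> S \<Longrightarrow> free n (U i) \<and> free n (V i) \<and> free n (W i)"
    and g: "free n g"
  shows "s * expct \<beta> (g * x ^ Suc a * y ^ b * prod f S) =
    real b * expct \<beta> ((1 - x * y) * (g * x ^ a * y ^ (b - 1) * prod f S)) +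
    expct \<beta> ((1 - x * y) * (g * x ^ a * y ^ b * (\<Sum>i\<in>S. W i * prod f (S - {i}))))"
  using fin f free g
proof (induction S arbitrary: g a b rule: finite_induct)
  case empty
  have 1: "expct \<beta> (g * x ^ a' * y ^ b') = expct \<beta> g * mom2 s a' b'" for a' b'
    by (rule xy[OF empty(3)])
  have "real b * expct \<beta> ((1 - x * y) * (g * x ^ a * y ^ (b - 1))) =
     real b * (expct \<beta> (g * x ^ a * y ^ (b - 1)) - expct \<beta> (g * x ^ Suc a * y ^ b))"
  proof (cases b)
    case (Suc b')
    show ?thesis unfolding expct_diff[symmetric] by (simp add: Suc algebra_simps)
  qed auto
  also have "\<dots> = s * (expct \<beta> g * mom2 s (Suc a) b)"
    unfolding 1 using arg_cong[OF mom2_parts[OF s, of a b], of "\<lambda>t. expct \<beta> g * t"]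
    by (simp add: algebra_simps)
  finally show ?case using 1[of "Suc a" b] by simp
next
  case (insert j S)
  let ?S = "\<Sum>i\<in>S. W i * prod f (S - {i})"
  have fr: "free n (U j)" "free n (V j)" "free n (W j)" using insert.prems by auto
  have fj: "f j = U j + x * V j + y * W j" using insert.prems by auto
  have IH: "s * expct \<beta> (h * x ^ Suc a * y ^ b * prod f S) =
    real b * expct \<beta> ((1 - x * y) * (h * x ^ a * y ^ (b - 1) * prod f S)) +
    expct \<beta> ((1 - x * y) * (h * x ^ a * y ^ b * ?S))" if "free n h" for h a b
    by (rule insert.IH) (use insert.prems that in auto)
  note gfree = free_mult[OF insert.prems(3)]
  have sum: "(\<Sum>i\<in>insert j S. W i * prod f (insert j S - {i})) = W j * prod f S + f j * ?S"
  proof -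
    have "(\<Sum>i\<in>S. W i * prod f (insert j S - {i})) = (\<Sum>i\<in>S. f j * (W i * prod f (S - {i})))"
    proof (rule sum.cong)
      fix i assume i: "i \<in> S"
      have "insert j S - {i} = insert j (S - {i})" using i insert by auto
      thus "W i * prod f (insert j S - {i}) = f j * (W i * prod f (S - {i}))"
        using insert by simp
    qed simp
    moreover have "insert j S - {j} = S" using insert by auto
    ultimately show ?thesis using insert by (simp add: sum_distrib_left)
  qed
  \<comment> \<open>The truncated exponent at b = 0 is harmless, since both sides carry the factor
    b.\<close>
  have yb: "real b * expct \<beta> (h * y ^ b) = real b * expct \<beta> (h * y ^ (b - 1) * y)" for h
    by (cases b) (auto simp: mult_ac)
  define Z where "Z = 1 - x * y"
  have "s * expct \<beta> (g * x ^ Suc a * y ^ b * prod f (insert j S)) =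
     s * expct \<beta> ((g * U j) * x ^ Suc a * y ^ b * prod f S) +
     s * expct \<beta> ((g * V j) * x ^ Suc (Suc a) * y ^ b * prod f S) +
     s * expct \<beta> ((g * W j) * x ^ Suc a * y ^ (Suc b) * prod f S)"
    unfolding distrib_left[symmetric] expct_add[symmetric] using insert.hyps
    by (simp add: fj algebra_simps)
  also have "\<dots> = 
    (real b * expct \<beta> (Z * ((g * U j) * x ^ a * y ^ (b - 1) * prod f S)) +
       expct \<beta> (Z * ((g * U j) * x ^ a * y ^ b * ?S))) +
    (real b * expct \<beta> (Z * ((g * V j) * x ^ Suc a * y ^ (b - 1) * prod f S)) +
       expct \<beta> (Z * ((g * V j) * x ^ Suc a * y ^ b * ?S))) +
    (real (Suc b) * expct \<beta> (Z * ((g * W j) * x ^ a * y ^ b * prod f S)) +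
       expct \<beta> (Z * ((g * W j) * x ^ a * y ^ Suc b * ?S)))"
    unfolding Z_def
    by (simp only: IH[OF gfree[OF fr(1)]] IH[OF gfree[OF fr(2)]] IH[OF gfree[OF fr(3)]] diff_Suc_1)
  \<comment> \<open>Of the b + 1 produced by y^(b+1), one unit is the derivative of the factor
    \<open>f j\<close> and b belong to the monomial.\<close>
  also have "real (Suc b) * expct \<beta> (Z * ((g * W j) * x ^ a * y ^ b * prod f S)) =
     expct \<beta> (Z * ((g * W j) * x ^ a * y ^ b * prod f S)) +
     real b * expct \<beta> (Z * ((g * W j) * x ^ a * y ^ (b - 1) * y * prod f S))"
    using yb[of "Z * (g * W j) * x ^ a * prod f S"] by (simp add: algebra_simps)
  finally have "s * expct \<beta> (g * x ^ Suc a * y ^ b * prod f (insert j S)) =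
    real b * (expct \<beta> (Z * ((g * U j) * x ^ a * y ^ (b - 1) * prod f S)) +
       expct \<beta> (Z * ((g * V j) * x ^ Suc a * y ^ (b - 1) * prod f S)) +
       expct \<beta> (Z * ((g * W j) * x ^ a * y ^ (b - 1) * y * prod f S))) +
    (expct \<beta> (Z * ((g * U j) * x ^ a * y ^ b * ?S)) +
     expct \<beta> (Z * ((g * V j) * x ^ Suc a * y ^ b * ?S)) +
     expct \<beta> (Z * ((g * W j) * x ^ a * y ^ b * prod f S)) +
     expct \<beta> (Z * ((g * W j) * x ^ a * y ^ Suc b * ?S)))"
    by (simp add: algebra_simps)
  also have "\<dots> = real b * expct \<beta> (Z * (g * x ^ a * y ^ (b - 1) * prod f (insert j S))) +
    expct \<beta> (Z * (g * x ^ a * y ^ b * (\<Sum>i\<in>insert j S. W i * prod f (insert j S - {i}))))"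
    unfolding expct_add[symmetric] sum using insert.hyps
    by (simp add: fj algebra_simps)
  finally show ?case by (simp add: Z_def)
qed

lemma expct_parts_X:
  assumes "\<beta> \<ge> 0" "finite S"
    and "\<And>i. i \<in> S \<Longrightarrow> f i = U i + varX n * V i + varY n * W i"
    and "\<And>i. i \<in> S \<Longrightarrow> free n (U i) \<and> free n (V i) \<and> free n (W i)"
    and "free n g"
  shows "real n * \<beta> * expct \<beta> (g * varX n * prod f S) =
    expct \<beta> ((1 - varX n * varY n) * (g * (\<Sum>i\<in>S. W i * prod f (S - {i}))))"
  using expct_parts[where x="varX n" and y="varY n" and a=0 and b=0 and s="real n * \<beta>",
      OF expct_free_power _ assms(2-5)] assms(1)
  by simp

lemma expct_parts_Y:
  assumes "\<beta> \<ge> 0" "finite S"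
    and "\<And>i. i \<in> S \<Longrightarrow> f i = U i + varX n * V i + varY n * W i"
    and "\<And>i. i \<in> S \<Longrightarrow> free n (U i) \<and> free n (V i) \<and> free n (W i)"
    and "free n g"
  shows "real n * \<beta> * expct \<beta> (g * varY n * prod f S) =
    expct \<beta> ((1 - varX n * varY n) * (g * (\<Sum>i\<in>S. V i * prod f (S - {i}))))"
proof -
  have *: "expct \<beta> (g * varY n ^ a * varX n ^ b) = expct \<beta> g * mom2 (real n * \<beta>) a b"
    if "free n g" for g a b
    using expct_free_power[OF that, of \<beta> b a] by (simp add: mult_ac mom2_def)
  show ?thesis
  using expct_parts[where x="varY n" and y="varX n" and a=0 and b=0 and s="real n * \<beta>" and U=U and V=W and W=V
    and f=f and S=S and n=n, OF *] assms
  by (simp add: mult_ac add_ac)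
qed

section \<open>Polynomials with nonnegative coefficients\<close>

definition pos_pol :: "mpol \<Rightarrow> bool" where
  "pos_pol F \<longleftrightarrow> (\<forall>k. Poly_Mapping.lookup F k \<ge> 0)"

lemma pos_pol_add: "pos_pol F \<Longrightarrow> pos_pol G \<Longrightarrow> pos_pol (F + G)"
  by (simp add: pos_pol_def lookup_add)

lemma pos_pol_mpmono [simp]: "pos_pol (mpmono k)"
  by (simp add: pos_pol_def mpmono_def lookup_single when_def)

lemma pos_pol_0 [simp]: "pos_pol 0" and pos_pol_1 [simp]: "pos_pol 1"
  using pos_pol_mpmono[of "({#},{#})"] by (simp_all add: pos_pol_def mpmono_0)

lemma pos_pol_sum: "(\<And>x. x \<in> S \<Longrightarrow> pos_pol (f x)) \<Longrightarrow> pos_pol (sum f S)"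
  by (induction S rule: infinite_finite_induct) (auto intro: pos_pol_add)

lemma pos_pol_mult:
  assumes "pos_pol F" "pos_pol G"
  shows "pos_pol (F * G)"
proof -
  have *: "pos_pol (Poly_Mapping.single k c)" if "c \<ge> 0" for k c
    using that by (simp add: pos_pol_def lookup_single when_def)
  have "F * G = (\<Sum>k\<in>Poly_Mapping.keys F. Poly_Mapping.single k (Poly_Mapping.lookup F k)) *
     (\<Sum>k\<in>Poly_Mapping.keys G. Poly_Mapping.single k (Poly_Mapping.lookup G k))"
    using mpol_sum_single[of F] mpol_sum_single[of G] by simp
  also have "pos_pol \<dots>"
    unfolding sum_product
    unfolding mult_single
    by (intro pos_pol_sum * mult_nonneg_nonneg) (use assms in \<open>auto simp: pos_pol_def\<close>)
  finally show ?thesis .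
qed

lemma pos_pol_prod: "(\<And>x. x \<in> S \<Longrightarrow> pos_pol (f x)) \<Longrightarrow> pos_pol (prod f S)"
  by (induction S rule: infinite_finite_induct) (auto intro: pos_pol_mult)

lemma expct_nonneg: "\<beta> \<ge> 0 \<Longrightarrow> pos_pol F \<Longrightarrow> expct \<beta> F \<ge> 0"
  by (auto simp: expct_def pos_pol_def intro!: sum_nonneg mult_nonneg_nonneg mono_wt_nonneg)

lemma expct_varX_varY:
  assumes "free n g"
  shows "expct \<beta> (varX n * varY n * g) = expct \<beta> g / (real n * \<beta> + 1)"
  using expct_free_power[OF assms, of \<beta> 1 1] by (simp add: mom2_def mom_def mult_ac)

text \<open>At level \<open>0\<close> the modulus is deterministic.\<close>
lemma expct_level_0: "expct \<beta> ((1 - varX 0 * varY 0) * g) = 0"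
proof -
  let ?r = "({#0#}, {#0#}) :: nat multiset \<times> nat multiset"
  have w: "mono_wt \<beta> (k + ?r) = mono_wt \<beta> k" for k
  proof -
    obtain a b where k: "k = (a, b)" by force
    have "(\<Prod>N\<in>insert 0 (set_mset a). mom (real N * \<beta>) (count (add_mset 0 a) N))
      = (\<Prod>N\<in>set_mset a. mom (real N * \<beta>) (count a N))"
      by (rule prod.mono_neutral_cong_right) auto
    thus ?thesis by (auto simp: k mono_wt_def simp del: prod.insert_if count_add_mset)
  qed
  have "varX 0 * varY 0 * g =
      mpmono ?r * (\<Sum>k\<in>Poly_Mapping.keys g. Poly_Mapping.single k (Poly_Mapping.lookup g k))"
    using mpol_sum_single[of g] by (simp add: varX_def varY_def mpmono_mult)
  also have "\<dots> = (\<Sum>k\<in>Poly_Mapping.keys g. Poly_Mapping.single (k + ?r) (Poly_Mapping.lookup g k))"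
    by (simp add: sum_distrib_left mpmono_def mult_single add.commute)
  finally have "expct \<beta> (varX 0 * varY 0 * g) = expct \<beta> g"
    by (simp add: expct_sum expct_single w) (simp add: expct_def)
  thus ?thesis by (simp add: left_diff_distrib expct_diff)
qed

section \<open>Transfer matrices\<close>

text \<open>A_n and D_n as polynomials in z; exchanging the arguments x and y gives the conjugate
  entries A'_n and D'_n.\<close>

fun fwdA fwdD :: "(nat \<Rightarrow> 'r) \<Rightarrow> (nat \<Rightarrow> 'r) \<Rightarrow> nat \<Rightarrow> 'r::comm_ring_1 poly" where
  "fwdA x y 0 = 1"
| "fwdA x y (Suc n) = fwdA x y n + smult (x n) (fwdD x y n)"
| "fwdD x y 0 = 0"
| "fwdD x y (Suc n) = pCons 0 (smult (y n) (fwdA x y n) + fwdD x y n)"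

text \<open>The product read from level M downwards: P and Q are the coefficients of A_n and D_n in
  A_M. The last argument counts the levels already passed from the top.\<close>

fun bwdP bwdQ :: "(nat \<Rightarrow> 'r) \<Rightarrow> (nat \<Rightarrow> 'r) \<Rightarrow> nat \<Rightarrow> nat \<Rightarrow> 'r::comm_ring_1 poly" where
  "bwdP x y M 0 = 1"
| "bwdP x y M (Suc k) = bwdP x y M k + smult (y (M - Suc k)) (pCons 0 (bwdQ x y M k))"
| "bwdQ x y M 0 = 0"
| "bwdQ x y M (Suc k) = smult (x (M - Suc k)) (bwdP x y M k) + pCons 0 (bwdQ x y M k)"

definition tailP :: "(nat \<Rightarrow> 'r) \<Rightarrow> (nat \<Rightarrow> 'r) \<Rightarrow> nat \<Rightarrow> nat \<Rightarrow> 'r::comm_ring_1 poly" where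
  "tailP x y M n = bwdP x y M (M - n)"
definition tailQ :: "(nat \<Rightarrow> 'r) \<Rightarrow> (nat \<Rightarrow> 'r) \<Rightarrow> nat \<Rightarrow> nat \<Rightarrow> 'r::comm_ring_1 poly" where
  "tailQ x y M n = bwdQ x y M (M - n)"

lemma tail_end [simp]: "tailP x y M M = 1" "tailQ x y M M = 0"
  by (simp_all add: tailP_def tailQ_def)

lemma tail_step:
  assumes "n < M"
  shows "tailP x y M n = tailP x y M (Suc n) + smult (y n) (pCons 0 (tailQ x y M (Suc n)))"
    "tailQ x y M n = smult (x n) (tailP x y M (Suc n)) + pCons 0 (tailQ x y M (Suc n))"
proof -
  have "M - n = Suc (M - Suc n)" "M - Suc (M - Suc n) = n" using assms by auto
  thus "tailP x y M n = tailP x y M (Suc n) + smult (y n) (pCons 0 (tailQ x y M (Suc n)))"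
    "tailQ x y M n = smult (x n) (tailP x y M (Suc n)) + pCons 0 (tailQ x y M (Suc n))"
    by (simp_all add: tailP_def tailQ_def)
qed

section \<open>Cutting one level out of the product\<close>

definition mixPA where "mixPA x y M n = tailP x y M (Suc n) * fwdA x y n"
definition mixPD where "mixPD x y M n = tailP x y M (Suc n) * fwdD x y n"
definition mixQA where "mixQA x y M n = pCons 0 (tailQ x y M (Suc n)) * fwdA x y n"
definition mixQD where "mixQD x y M n = pCons 0 (tailQ x y M (Suc n)) * fwdD x y n"

text \<open>Step n is absorbed into the tail here and into the head in the next lemma. The
  telescoping identities below compare these two expansions.\<close>

lemma mix_here:
  assumes "n < M"
  shows "tailP x y M n * fwdA x y n = mixPA x y M n + smult (y n) (mixQA x y M n)"
    "tailP x y M n * fwdD x y n = mixPD x y M n + smult (y n) (mixQD x y M n)"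
    "tailQ x y M n * fwdA x y n = smult (x n) (mixPA x y M n) + mixQA x y M n"
    "tailQ x y M n * fwdD x y n = smult (x n) (mixPD x y M n) + mixQD x y M n"
  unfolding tail_step[OF assms] mixPA_def mixPD_def mixQA_def mixQD_def
  by (simp_all add: algebra_simps smult_add_right)

lemma mix_next:
  shows "tailP x y M (Suc n) * fwdA x y (Suc n) = mixPA x y M n + smult (x n) (mixPD x y M n)"
    "tailP x y M (Suc n) * fwdD x y (Suc n) = pCons 0 (smult (y n) (mixPA x y M n) + mixPD x y M n)"
    "pCons 0 (tailQ x y M (Suc n) * fwdA x y (Suc n)) = mixQA x y M n + smult (x n) (mixQD x y M n)"
    "tailQ x y M (Suc n) * fwdD x y (Suc n) = smult (y n) (mixQA x y M n) + mixQD x y M n"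
  unfolding mixPA_def mixPD_def mixQA_def mixQD_def
  by (simp_all add: algebra_simps smult_add_right)

lemma fwd_tail_invariant:
  assumes "n \<le> M"
  shows "fwdA x y M = tailP x y M n * fwdA x y n + tailQ x y M n * fwdD x y n"
  using assms
proof (induction "M - n" arbitrary: n)
  case (Suc k)
  hence n: "n < M" by simp
  have "k = M - Suc n" "Suc n \<le> M" using Suc by auto
  from Suc(1)[OF this] show ?case
    by (simp only: mix_here[OF n] mix_next) (simp add: algebra_simps)
qed auto

text \<open>A single transfer step contains no product of \<open>x n\<close> and \<open>y n\<close>.
  Thus \<open>mixPD\<close> and \<open>mixQA\<close> are the derivatives of A_M in
  \<open>x n\<close> and \<open>y n\<close>.\<close>

lemma fwdA_affine:
  assumes "n < M"
  shows "fwdA x y M = (mixPA x y M n + mixQD x y M n) +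
    smult (x n) (mixPD x y M n) + smult (y n) (mixQA x y M n)"
  by (simp only: fwd_tail_invariant[OF less_imp_le[OF assms], of x y] mix_here[OF assms])
    (simp add: algebra_simps)

section \<open>The operator z d/dz and weighted homogeneity\<close>

definition euler :: "'r::comm_ring_1 poly \<Rightarrow> 'r poly" where
  "euler f = Poly (map (\<lambda>c. of_nat c * coeff f c) [0..<Suc (degree f)])"

lemma coeff_euler: "coeff (euler f) c = of_nat c * coeff f c"
proof (cases "c \<le> degree f")
  case True
  hence "c < Suc (degree f)" by simp
  hence "map (\<lambda>c. of_nat c * coeff f c) [0..<Suc (degree f)] ! c = of_nat c * coeff f c"
    by (subst nth_map) (auto simp del: upt_Suc)
  thus ?thesis using True by (simp add: euler_def nth_default_def del: upt_Suc)
qed (simp add: euler_def nth_default_def coeff_eq_0)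

lemma euler_simps:
  "euler (f + g) = euler f + euler g" "euler (smult a f) = smult a (euler f)"
  "euler (pCons 0 f) = pCons 0 f + pCons 0 (euler f)" "euler 0 = 0" "euler 1 = 0"
proof -
  show "euler (pCons 0 f) = pCons 0 f + pCons 0 (euler f)"
    by (rule poly_eqI) (auto simp: coeff_euler coeff_pCons algebra_simps split: nat.splits)
qed (auto intro!: poly_eqI simp: coeff_euler algebra_simps)

text \<open>Each step contains z only as a factor of its lower component, so by the product rule z
  d/dz picks up exactly Q_(n+1) D_(n+1) at step n.\<close>

lemma euler_fwdA: "euler (fwdA x y M) = (\<Sum>n<M. tailQ x y M (Suc n) * fwdD x y (Suc n))"
proof -
  define r where "r k = tailQ x y M (Suc k) * fwdD x y (Suc k)" for k
  have "tailP x y M n * euler (fwdA x y n) + tailQ x y M n * euler (fwdD x y n) = (\<Sum>k<n. r k)" if "n \<le> M" for n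
    using that
  proof (induction n)
    case (Suc n)
    hence "n < M" by simp
    have "tailP x y M (Suc n) * euler (fwdA x y (Suc n)) + tailQ x y M (Suc n) * euler (fwdD x y (Suc n))
       = (tailP x y M n * euler (fwdA x y n) + tailQ x y M n * euler (fwdD x y n)) + r n"
      by (simp add: tail_step[OF \<open>n < M\<close>] euler_simps algebra_simps smult_add_right r_def)
    thus ?case using Suc by simp
  qed (simp add: euler_simps)
  from this[of M] show ?thesis by (simp add: r_def)
qed

text \<open>Terms of the coefficient of z^c are words whose x-levels minus y-levels sum to c, so
  this weighted Euler field has eigenvalue -c. The proof is summation by parts:
  \<open>y n * mixQA - x n * mixPD\<close> is the increment of Q_n D_n.\<close>

lemma coeff_fwdA_weighted:
  "(\<Sum>n<M. of_nat n * (y n * coeff (mixQA x y M n) c - x n * coeff (mixPD x y M n) c)) =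
    - (of_nat c * coeff (fwdA x y M) c)"
proof -
  define r where "r n = coeff (tailQ x y M n * fwdD x y n) c" for n
  have "(\<Sum>n<k. of_nat n * (r (Suc n) - r n)) = of_nat k * r k - (\<Sum>n<k. r (Suc n))" for k
    by (induction k) (auto simp: algebra_simps)
  \<comment> \<open>The boundary term drops out because Q_M = 0.\<close>
  from this[of M] have "(\<Sum>n<M. of_nat n * (r (Suc n) - r n)) = - (\<Sum>n<M. r (Suc n))"
    by (simp add: r_def)
  also have "(\<Sum>n<M. r (Suc n)) = coeff (euler (fwdA x y M)) c"
    by (simp add: euler_fwdA coeff_sum r_def)
  also have "\<dots> = of_nat c * coeff (fwdA x y M) c" by (rule coeff_euler)
  also have "(\<Sum>n<M. of_nat n * (r (Suc n) - r n)) =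
     (\<Sum>n<M. of_nat n * (y n * coeff (mixQA x y M n) c - x n * coeff (mixPD x y M n) c))"
    by (intro sum.cong refl) (simp add: r_def mix_next mix_here del: fwdD.simps)
  finally show ?thesis .
qed

section \<open>The vector field X on A_M and on A'_M\<close>

text \<open>Coefficientwise form of a Christoffel--Darboux identity: the bilinear form
  \<open>(P(w)Q(z) - Q(w)P(z)) * (z D(w) A(z) - w A(w) D(z))\<close> telescopes along the transfer
  steps, and it vanishes at both ends.\<close>
lemma field_holomorphic:
  fixes x y :: "nat \<Rightarrow> 'r::comm_ring_1"
  shows "(\<Sum>n<M. (1 - x n * y n) * (coeff (mixQA x y M n) c * coeff (mixPD x y M n) m
    - coeff (mixPD x y M n) c * coeff (mixQA x y M n) m)) = 0"
proof -
  define sh where "sh = (pCons 0 :: 'r poly \<Rightarrow> 'r poly)"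
  define PA PD QA QD where "PA n = tailP x y M n * fwdA x y n" and "PD n = tailP x y M n * fwdD x y n"
    and "QA n = tailQ x y M n * fwdA x y n" and "QD n = tailQ x y M n * fwdD x y n" for n
  define S where "S n c m = coeff (PD n) c * coeff (sh (QA n)) m - coeff (sh (PA n)) c * coeff (QD n) m
      - coeff (QD n) c * coeff (sh (PA n)) m + coeff (sh (QA n)) c * coeff (PD n) m" for n c m
  define T where "T n f g c m = (1 - x n * y n) * (coeff (f (mixQA x y M n)) c * coeff (g (mixPD x y M n)) m
    - coeff (f (mixPD x y M n)) c * coeff (g (mixQA x y M n)) m)" for n f g c m
  \<comment> \<open>The increment of the bilinear form is z - w times the summand; \<open>sh\<close>
    in the second slot is multiplication by z, in the first slot by w.\<close>
  have step: "S (Suc n) c m - S n c m = T n (\<lambda>f. f) sh c m - T n sh (\<lambda>f. f) c m" if "n < M" for n c m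
    unfolding S_def T_def PA_def PD_def QA_def QD_def sh_def mix_here[OF that] mix_next
    by (simp add: coeff_pCons algebra_simps split: nat.splits)
  have "(\<Sum>n<M. T n (\<lambda>f. f) sh c m) - (\<Sum>n<M. T n sh (\<lambda>f. f) c m) = S M c m - S 0 c m" for c m
    unfolding sum_subtractf[symmetric] sum_lessThan_telescope[of "\<lambda>n. S n c m", symmetric]
    by (rule sum.cong) (simp_all add: step)
  also have "S M c m - S 0 c m = 0" for c m
    by (simp add: S_def PA_def PD_def QA_def QD_def sh_def)
  finally have eq: "(\<Sum>n<M. T n (\<lambda>f. f) sh c m) = (\<Sum>n<M. T n sh (\<lambda>f. f) c m)" for c m
    by simp
  \<comment> \<open>Multiplication by z - w is injective: \<open>eq\<close> equates the coefficients
    at (c, m + 1) and (c + 1, m), and for m = 0 it gives zero.\<close>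
  have "(\<Sum>n<M. T n (\<lambda>f. f) (\<lambda>f. f) c m) = 0" for c
  proof (induction m arbitrary: c)
    case 0
    show ?case using eq[of "Suc c" 0] by (simp add: T_def sh_def)
  next
    case (Suc m)
    show ?case using eq[of "Suc c" "Suc m"] Suc[of "Suc c"] by (simp add: T_def sh_def)
  qed
  thus ?thesis by (simp add: T_def)
qed

text \<open>The coefficient of w^c z^m in X A'_M(z), where X has component (1 - x_n y_n)
  \<open>mixQA\<close>(w) along \<open>x n\<close> and minus (1 - x_n y_n) \<open>mixPD\<close>(w)
  along \<open>y n\<close>. For A'_M the roles are exchanged: its x-derivative is a
  \<open>mixQA\<close> and its y-derivative a \<open>mixPD\<close>.\<close>

definition antifield :: "(nat \<Rightarrow> 'r) \<Rightarrow> (nat \<Rightarrow> 'r) \<Rightarrow> nat \<Rightarrow> nat \<Rightarrow> nat \<Rightarrow> 'r::comm_ring_1" where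
  "antifield x y M c m = (\<Sum>n<M. (1 - x n * y n) *
     (coeff (mixQA x y M n) c * coeff (mixQA y x M n) m - coeff (mixPD x y M n) c * coeff (mixPD y x M n) m))"

text \<open>Here \<open>(P(w)P'(z) - Q(w)Q'(z)) * (D(w)D'(z) - w z A(w)A'(z))\<close> telescopes, where the prime
  denotes the exchange of \<open>x\<close> and \<open>y\<close>. The last term is the contribution of the first step.\<close>
lemma antifield_eq:
  fixes x y :: "nat \<Rightarrow> 'r::comm_ring_1"
  assumes M: "M > 0"
  shows "\<exists>g. antifield x y M c m =
    (\<Sum>t\<le>min c m. coeff (fwdD x y M) (c - t) * coeff (fwdD y x M) (m - t))
    - (\<Sum>t<min c m. coeff (fwdA x y M) (c - Suc t) * coeff (fwdA y x M) (m - Suc t))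
    + (1 - x 0 * y 0) * g"
proof -
  define sh where "sh = (pCons 0 :: 'r poly \<Rightarrow> 'r poly)"
  define PA PD QA QD where "PA x y n = tailP x y M n * fwdA x y n" and "PD x y n = tailP x y M n * fwdD x y n"
    and "QA x y n = tailQ x y M n * fwdA x y n" and "QD x y n = tailQ x y M n * fwdD x y n"
    for n and x y :: "nat \<Rightarrow> 'r"
  define S where "S n c m = coeff (PD x y n) c * coeff (PD y x n) m
      - coeff (sh (PA x y n)) c * coeff (sh (PA y x n)) m
      - coeff (QD x y n) c * coeff (QD y x n) m + coeff (sh (QA x y n)) c * coeff (sh (QA y x n)) m" for n c m
  define T where "T n f c m = (1 - x n * y n) * (coeff (f (mixQA x y M n)) c * coeff (f (mixQA y x M n)) m
    - coeff (f (mixPD x y M n)) c * coeff (f (mixPD y x M n)) m)" for n f c m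
  \<comment> \<open>Here the increment is 1 - w z times the summand.\<close>
  have step: "S (Suc n) c m - S n c m = T n (\<lambda>f. f) c m - T n sh c m" if "n < M" for n c m
    unfolding S_def T_def PA_def PD_def QA_def QD_def sh_def mix_here[OF that] mix_next
    by (simp add: coeff_pCons algebra_simps split: nat.splits)
  have tel: "(\<Sum>n<M. T n (\<lambda>f. f) c m) - (\<Sum>n<M. T n sh c m) = S M c m - S 0 c m" for c m
    unfolding sum_subtractf[symmetric] sum_lessThan_telescope[of "\<lambda>n. S n c m", symmetric]
    by (rule sum.cong) (simp_all add: step)
  have SM: "S M c m = coeff (fwdD x y M) c * coeff (fwdD y x M) m
     - coeff (sh (fwdA x y M)) c * coeff (sh (fwdA y x M)) m" for c m
    by (simp add: S_def PA_def PD_def QA_def QD_def sh_def)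
  \<comment> \<open>Since A_0 = 1 and D_0 = 0, only P_0 P'_0 - Q_0 Q'_0 enters, and one step back
    gives (1 - x_0 y_0) (P_1 P'_1 - w z Q_1 Q'_1) for it.\<close>
  have "\<exists>g. S 0 c m = - ((1 - x 0 * y 0) * g)" for c m
  proof 
    show "S 0 c m = - ((1 - x 0 * y 0) * (coeff (sh (tailP x y M 1)) c * coeff (sh (tailP y x M 1)) m
       - coeff (sh (sh (tailQ x y M 1))) c * coeff (sh (sh (tailQ y x M 1))) m))"
      unfolding S_def PA_def PD_def QA_def QD_def sh_def
      by (simp add: tail_step[OF M] coeff_pCons algebra_simps split: nat.splits)
  qed
  then obtain g0 where g0: "\<And>c m. S 0 c m = - ((1 - x 0 * y 0) * g0 c m)" by metis
  have anti: "antifield x y M c m = (\<Sum>n<M. T n (\<lambda>f. f) c m)" for c m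
    by (simp add: antifield_def T_def)
  \<comment> \<open>Division by 1 - w z: the coefficient at (c - 1, m - 1) feeds the one at (c, m),
    and unrolling the diagonal produces the two sums.\<close>
  have rec: "antifield x y M c m = (if c = 0 \<or> m = 0 then 0 else antifield x y M (c - 1) (m - 1)) +
      coeff (fwdD x y M) c * coeff (fwdD y x M) m
     - coeff (sh (fwdA x y M)) c * coeff (sh (fwdA y x M)) m + (1 - x 0 * y 0) * g0 c m" for c m
  proof -
    have "(\<Sum>n<M. T n sh c m) = (if c = 0 \<or> m = 0 then 0 else antifield x y M (c - 1) (m - 1))"
      by (cases c; cases m) (simp_all add: anti T_def sh_def)
    thus ?thesis using tel[of c m] unfolding anti SM g0 by (simp add: algebra_simps)
  qed
  show ?thesis
  proof (induction c arbitrary: m)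
    case 0
    show ?case by (rule exI[of _ "g0 0 m"], subst rec) (simp add: sh_def)
  next
    case (Suc c)
    show ?case
    proof (cases m)
      case 0
      show ?thesis by (rule exI[of _ "g0 (Suc c) m"], subst rec) (simp add: sh_def 0)
    next
      case (Suc m')
      obtain g where g: "antifield x y M c m' =
         (\<Sum>t\<le>min c m'. coeff (fwdD x y M) (c - t) * coeff (fwdD y x M) (m' - t))
        - (\<Sum>t<min c m'. coeff (fwdA x y M) (c - Suc t) * coeff (fwdA y x M) (m' - Suc t))
        + (1 - x 0 * y 0) * g" using Suc.IH by blast
      show ?thesis
        by (rule exI[of _ "g + g0 (Suc c) m"], subst rec)
           (simp add: Suc g sh_def sum.atMost_Suc_shift sum.lessThan_Suc_shift algebra_simps
             del: sum.atMost_Suc sum.lessThan_Suc)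
    qed
  qed
qed

section \<open>Correlations at finite level and their recursion\<close>

definition freeP :: "nat \<Rightarrow> mpol poly \<Rightarrow> bool" where
  "freeP k f \<longleftrightarrow> (\<forall>c. free k (coeff f c))"

lemma freeP_intros:
  "freeP k f \<Longrightarrow> freeP k g \<Longrightarrow> freeP k (f + g)"
  "free k a \<Longrightarrow> freeP k f \<Longrightarrow> freeP k (smult a f)"
  "freeP k f \<Longrightarrow> freeP k (pCons 0 f)"
  "freeP k f \<Longrightarrow> freeP k g \<Longrightarrow> freeP k (f * g)"
  "freeP k 0" "freeP k 1"
  by (auto simp: freeP_def coeff_mult coeff_pCons one_pCons
        intro!: free_add free_mult free_sum split: nat.splits)

lemma freeP_fwd:
  assumes "\<And>j. j \<noteq> k \<Longrightarrow> free k (x j) \<and> free k (y j)" "n \<le> k"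
  shows "freeP k (fwdA x y n)" "freeP k (fwdD x y n)"
proof -
  have "freeP k (fwdA x y n) \<and> freeP k (fwdD x y n)"
    using assms(2) by (induction n) (use assms(1) in \<open>auto intro!: freeP_intros\<close>)
  thus "freeP k (fwdA x y n)" "freeP k (fwdD x y n)" by auto
qed

lemma freeP_tail:
  assumes "\<And>j. j \<noteq> k \<Longrightarrow> free k (x j) \<and> free k (y j)" "k < n" "n \<le> M"
  shows "freeP k (tailP x y M n)" "freeP k (tailQ x y M n)"
proof -
  have "freeP k (bwdP x y M i) \<and> freeP k (bwdQ x y M i)" if "i \<le> M - Suc k" for i
    using that
  proof (induction i)
    case (Suc i)
    have "M - Suc i \<noteq> k" using Suc.prems assms by auto
    with Suc assms(1) show ?case by (auto intro!: freeP_intros)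
  qed (auto intro: freeP_intros)
  thus "freeP k (tailP x y M n)" "freeP k (tailQ x y M n)"
    using assms(2,3) by (auto simp: tailP_def tailQ_def)
qed

lemma freeP_mix:
  assumes "\<And>j. j \<noteq> k \<Longrightarrow> free k (x j) \<and> free k (y j)" "k < M"
  shows "freeP k (mixPA x y M k)" "freeP k (mixPD x y M k)"
    "freeP k (mixQA x y M k)" "freeP k (mixQD x y M k)"
  using freeP_fwd[of k x y k] freeP_tail[of k x y "Suc k" M] assms
  by (auto simp: mixPA_def mixPD_def mixQA_def mixQD_def intro!: freeP_intros)

abbreviation "hA M c \<equiv> coeff (fwdA varX varY M) c"
abbreviation "hD M c \<equiv> coeff (fwdD varX varY M) c"
abbreviation "aA M c \<equiv> coeff (fwdA varY varX M) c"
abbreviation "aD M c \<equiv> coeff (fwdD varY varX M) c"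

definition corr :: "real \<Rightarrow> nat \<Rightarrow> 'a set \<Rightarrow> 'b set \<Rightarrow> ('a \<Rightarrow> nat) \<Rightarrow> ('b \<Rightarrow> nat) \<Rightarrow> real" where
  "corr \<beta> M I K \<nu> \<mu> = expct \<beta> ((\<Prod>i\<in>I. hA M (\<nu> i)) * (\<Prod>k\<in>K. aA M (\<mu> k)))"

text \<open>A correlation in which one A_M and one A'_M are replaced by D_M and D'_M; this is the
  error term of the recursion.\<close>

definition edge :: "real \<Rightarrow> nat \<Rightarrow> 'a set \<Rightarrow> 'b set \<Rightarrow> 'a \<Rightarrow> 'b \<Rightarrow> ('a \<Rightarrow> nat) \<Rightarrow> ('b \<Rightarrow> nat) \<Rightarrow> real" where
  "edge \<beta> M I K i0 k0 \<nu> \<mu> = expct \<beta> (hD M (\<nu> i0) * aD M (\<mu> k0) *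
     ((\<Prod>i\<in>I - {i0}. hA M (\<nu> i)) * (\<Prod>k\<in>K - {k0}. aA M (\<mu> k))))"

text \<open>A disjoint sum indexes both kinds of remaining factors, with \<open>V\<close> and
  \<open>W\<close> their derivatives in \<open>x n\<close> and \<open>y n\<close>. Integrating the
  y-term and the x-term by parts moves the Euler field of the factor \<open>i0\<close> onto the
  others as the field X.\<close>

lemma corr_parts:
  fixes \<nu> :: "'a \<Rightarrow> nat" and \<mu> :: "'b \<Rightarrow> nat"
  assumes \<beta>: "\<beta> \<ge> 0" and fin: "finite I" "finite K" and i0: "i0 \<in> I" and n: "n < M"
  defines "S \<equiv> (I - {i0}) <+> K"
  defines "f \<equiv> case_sum (\<lambda>i. hA M (\<nu> i)) (\<lambda>k. aA M (\<mu> k))"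
  defines "V \<equiv> case_sum (\<lambda>i. coeff (mixPD varX varY M n) (\<nu> i)) (\<lambda>k. coeff (mixQA varY varX M n) (\<mu> k))"
  defines "W \<equiv> case_sum (\<lambda>i. coeff (mixQA varX varY M n) (\<nu> i)) (\<lambda>k. coeff (mixPD varY varX M n) (\<mu> k))"
  shows "real n * \<beta> * expct \<beta> ((varY n * coeff (mixQA varX varY M n) c - varX n * coeff (mixPD varX varY M n) c) * prod f S)
    = (\<Sum>i\<in>S. expct \<beta> ((1 - varX n * varY n) * (coeff (mixQA varX varY M n) c * V i - coeff (mixPD varX varY M n) c * W i)
        * prod f (S - {i})))"
proof -
  define U where "U = case_sum (\<lambda>i. coeff (mixPA varX varY M n + mixQD varX varY M n) (\<nu> i))
    (\<lambda>k. coeff (mixPA varY varX M n + mixQD varY varX M n) (\<mu> k))"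
  have XY: "free n (varX j) \<and> free n (varY j)" "free n (varY j) \<and> free n (varX j)" if "j \<noteq> n" for j
    using that by (auto intro: free_varX free_varY)
  note fr = freeP_mix[of n varX varY M, OF XY(1) n] freeP_mix[of n varY varX M, OF XY(2) n]
  have f: "f i = U i + varX n * V i + varY n * W i" if "i \<in> S" for i
    unfolding f_def U_def V_def W_def fwdA_affine[OF n] by (cases i) simp_all
  have free: "free n (U i) \<and> free n (V i) \<and> free n (W i)" if "i \<in> S" for i
    using fr unfolding U_def V_def W_def freeP_def by (cases i) (auto intro!: free_add)
  have finS: "finite S" using fin by (simp add: S_def)
  have qa: "free n (coeff (mixQA varX varY M n) c)" and pd: "free n (coeff (mixPD varX varY M n) c)"
    using fr by (auto simp: freeP_def)
  have "real n * \<beta> * expct \<beta> ((varY n * coeff (mixQA varX varY M n) c - varX n * coeff (mixPD varX varY M n) c) * prod f S)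
    = real n * \<beta> * expct \<beta> (coeff (mixQA varX varY M n) c * varY n * prod f S)
      - real n * \<beta> * expct \<beta> (coeff (mixPD varX varY M n) c * varX n * prod f S)"
    by (simp add: expct_diff[symmetric] right_diff_distrib[symmetric] algebra_simps)
  also have "\<dots> = expct \<beta> ((1 - varX n * varY n) * (coeff (mixQA varX varY M n) c * (\<Sum>i\<in>S. V i * prod f (S - {i}))))
      - expct \<beta> ((1 - varX n * varY n) * (coeff (mixPD varX varY M n) c * (\<Sum>i\<in>S. W i * prod f (S - {i}))))"
    by (simp only: expct_parts_Y[of \<beta> S f U n V W, OF \<beta> finS f free qa]
        expct_parts_X[of \<beta> S f U n V W, OF \<beta> finS f free pd])
  also have "\<dots> = (\<Sum>i\<in>S. expct \<beta> ((1 - varX n * varY n) * (coeff (mixQA varX varY M n) c * V i - coeff (mixPD varX varY M n) c * W i)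
        * prod f (S - {i})))"
    by (simp add: expct_diff[symmetric] expct_sum[symmetric] sum_distrib_left sum_subtractf[symmetric] algebra_simps)
  finally show ?thesis .
qed

text \<open>Summing over levels yields E(X F) = -\<beta> E(w (dA_M/dw) F) for the product F of the
  remaining factors. Homogeneity evaluates one side; on the other only the factors A'_M
  survive.\<close>

lemma corr_field:
  assumes \<beta>: "\<beta> \<ge> 0" and fin: "finite I" "finite K" and i0: "i0 \<in> I"
  shows "\<beta> * real (\<nu> i0) * corr \<beta> M I K \<nu> \<mu> =
    - (\<Sum>k\<in>K. expct \<beta> (antifield varX varY M (\<nu> i0) (\<mu> k) *
        ((\<Prod>i\<in>I - {i0}. hA M (\<nu> i)) * (\<Prod>j\<in>K - {k}. aA M (\<mu> j)))))"
proof -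
  define S where "S = (I - {i0}) <+> K"
  define f where "f = case_sum (\<lambda>i. hA M (\<nu> i)) (\<lambda>k. aA M (\<mu> k))"
  define V where "V n = case_sum (\<lambda>i. coeff (mixPD varX varY M n) (\<nu> i)) (\<lambda>k. coeff (mixQA varY varX M n) (\<mu> k))" for n
  define W where "W n = case_sum (\<lambda>i. coeff (mixQA varX varY M n) (\<nu> i)) (\<lambda>k. coeff (mixPD varY varX M n) (\<mu> k))" for n
  define c where "c = \<nu> i0"
  define D where "D i = (\<Sum>n<M. (1 - varX n * varY n) *
     (coeff (mixQA varX varY M n) c * V n i - coeff (mixPD varX varY M n) c * W n i))" for i
  let ?r = "\<lambda>n. varY n * coeff (mixQA varX varY M n) c - varX n * coeff (mixPD varX varY M n) c"
  have "(\<Sum>n<M. real n * \<beta> * expct \<beta> (?r n * prod f S)) = \<beta> * expct \<beta> ((\<Sum>n<M. of_nat n * ?r n) * prod f S)"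
    by (simp add: sum_distrib_right sum_distrib_left expct_sum expct_of_nat_mult mult_ac)
  also have "\<dots> = - (\<beta> * real c * expct \<beta> (hA M c * prod f S))"
    by (simp add: coeff_fwdA_weighted expct_uminus expct_of_nat_mult mult_ac)
  also have "hA M c * prod f S = (\<Prod>i\<in>I. hA M (\<nu> i)) * (\<Prod>k\<in>K. aA M (\<mu> k))"
    using fin i0 by (simp add: S_def f_def c_def prod.Plus prod.remove[of I i0] mult_ac)
  finally have L: "(\<Sum>n<M. real n * \<beta> * expct \<beta> (?r n * prod f S)) = - (\<beta> * real c * corr \<beta> M I K \<nu> \<mu>)"
    by (simp add: corr_def)
  have "(\<Sum>n<M. real n * \<beta> * expct \<beta> (?r n * prod f S)) = (\<Sum>n<M. \<Sum>i\<in>S. expct \<beta> ((1 - varX n * varY n) *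
     (coeff (mixQA varX varY M n) c * V n i - coeff (mixPD varX varY M n) c * W n i) * prod f (S - {i})))"
    unfolding S_def f_def V_def W_def
    by (intro sum.cong refl corr_parts) (use assms in auto)
  also have "\<dots> = (\<Sum>i\<in>S. expct \<beta> (D i * prod f (S - {i})))"
    unfolding D_def by (subst sum.swap) (simp add: expct_sum sum_distrib_right)
  also have "\<dots> = (\<Sum>i\<in>I - {i0}. expct \<beta> (D (Inl i) * prod f (S - {Inl i}))) +
      (\<Sum>k\<in>K. expct \<beta> (D (Inr k) * prod f (S - {Inr k})))"
    using fin by (simp add: S_def sum.Plus)
  \<comment> \<open>X annihilates A_M.\<close>
  also have "(\<Sum>i\<in>I - {i0}. expct \<beta> (D (Inl i) * prod f (S - {Inl i}))) = 0"
    by (simp add: D_def V_def W_def field_holomorphic)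
  also have "(\<Sum>k\<in>K. expct \<beta> (D (Inr k) * prod f (S - {Inr k}))) =
     (\<Sum>k\<in>K. expct \<beta> (antifield varX varY M (\<nu> i0) (\<mu> k) *
        ((\<Prod>i\<in>I - {i0}. hA M (\<nu> i)) * (\<Prod>j\<in>K - {k}. aA M (\<mu> j)))))"
  proof (intro sum.cong refl)
    fix k assume "k \<in> K"
    have "S - {Inr k} = (I - {i0}) <+> (K - {k})" by (auto simp: S_def)
    thus "expct \<beta> (D (Inr k) * prod f (S - {Inr k})) = expct \<beta> (antifield varX varY M (\<nu> i0) (\<mu> k) *
        ((\<Prod>i\<in>I - {i0}. hA M (\<nu> i)) * (\<Prod>j\<in>K - {k}. aA M (\<mu> j))))"
      using fin by (simp add: prod.Plus f_def D_def V_def W_def antifield_def c_def)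
  qed
  finally show ?thesis using L by (simp add: c_def)
qed

text \<open>The formula for X A'_M is inserted; its multiple of 1 - x_0 y_0 has expectation zero
  since level 0 lies on the unit circle.\<close>

lemma corr_recursion:
  assumes \<beta>: "\<beta> \<ge> 0" and fin: "finite I" "finite K" and i0: "i0 \<in> I" and M: "M > 0"
  shows "\<beta> * real (\<nu> i0) * corr \<beta> M I K \<nu> \<mu> =
    (\<Sum>k\<in>K. (\<Sum>t<min (\<nu> i0) (\<mu> k). corr \<beta> M I K (\<nu>(i0 := \<nu> i0 - Suc t)) (\<mu>(k := \<mu> k - Suc t)))
      - (\<Sum>t\<le>min (\<nu> i0) (\<mu> k). edge \<beta> M I K i0 k (\<nu>(i0 := \<nu> i0 - t)) (\<mu>(k := \<mu> k - t))))"
proof -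
  have "expct \<beta> (antifield varX varY M (\<nu> i0) (\<mu> k) *
        ((\<Prod>i\<in>I - {i0}. hA M (\<nu> i)) * (\<Prod>j\<in>K - {k}. aA M (\<mu> j)))) =
     - ((\<Sum>t<min (\<nu> i0) (\<mu> k). corr \<beta> M I K (\<nu>(i0 := \<nu> i0 - Suc t)) (\<mu>(k := \<mu> k - Suc t)))
      - (\<Sum>t\<le>min (\<nu> i0) (\<mu> k). edge \<beta> M I K i0 k (\<nu>(i0 := \<nu> i0 - t)) (\<mu>(k := \<mu> k - t))))"
    if k: "k \<in> K" for k
  proof -
    let ?F = "(\<Prod>i\<in>I - {i0}. hA M (\<nu> i)) * (\<Prod>j\<in>K - {k}. aA M (\<mu> j))"
    obtain g where g: "antifield varX varY M (\<nu> i0) (\<mu> k) =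
    (\<Sum>t\<le>min (\<nu> i0) (\<mu> k). hD M (\<nu> i0 - t) * aD M (\<mu> k - t))
    - (\<Sum>t<min (\<nu> i0) (\<mu> k). hA M (\<nu> i0 - Suc t) * aA M (\<mu> k - Suc t))
    + (1 - varX 0 * varY 0) * g"
      using antifield_eq[OF M] by blast
    have "expct \<beta> (antifield varX varY M (\<nu> i0) (\<mu> k) * ?F) = 
      (\<Sum>t\<le>min (\<nu> i0) (\<mu> k). expct \<beta> (hD M (\<nu> i0 - t) * aD M (\<mu> k - t) * ?F))
      - (\<Sum>t<min (\<nu> i0) (\<mu> k). expct \<beta> (hA M (\<nu> i0 - Suc t) * aA M (\<mu> k - Suc t) * ?F))
      + expct \<beta> ((1 - varX 0 * varY 0) * (g * ?F))"
      unfolding g by (simp only: distrib_right left_diff_distrib expct_add expct_diff sum_distrib_right expct_sum mult.assoc)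
    moreover have "expct \<beta> (hD M a * aD M b * ?F) = edge \<beta> M I K i0 k (\<nu>(i0 := a)) (\<mu>(k := b))" for a b
      unfolding edge_def by (intro arg_cong[of _ _ "expct \<beta>"] arg_cong2[of _ _ _ _ "(*)"] prod.cong) auto
    moreover have "expct \<beta> (hA M a * aA M b * ?F) = corr \<beta> M I K (\<nu>(i0 := a)) (\<mu>(k := b))" for a b
    proof -
      have "(\<Prod>i\<in>I. hA M ((\<nu>(i0 := a)) i)) = hA M a * (\<Prod>i\<in>I - {i0}. hA M (\<nu> i))"
        using prod.remove[OF fin(1) i0, of "\<lambda>i. hA M ((\<nu>(i0 := a)) i)"] by simp
      moreover have "(\<Prod>j\<in>K. aA M ((\<mu>(k := b)) j)) = aA M b * (\<Prod>j\<in>K - {k}. aA M (\<mu> j))"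
        using prod.remove[OF fin(2) k, of "\<lambda>j. aA M ((\<mu>(k := b)) j)"] by simp
      ultimately show ?thesis by (simp add: corr_def mult_ac)
    qed
    ultimately show ?thesis by (simp add: expct_level_0)
  qed
  thus ?thesis unfolding corr_field[OF assms(1-4)] by (simp add: sum_negf[symmetric])
qed

section \<open>Products of complete homogeneous symmetric functions\<close>

definition partitions :: "nat \<Rightarrow> (nat \<Rightarrow> nat) set" where
  "partitions d = {L. multi_index L \<and> mi_deg L = d}"

text \<open>The number z_L for which d! / z_L permutations of d points have cycle type L.\<close>

definition centralizer :: "(nat \<Rightarrow> nat) \<Rightarrow> real" where
  "centralizer L = (\<Prod>u | L u \<noteq> 0. fact (L u) * real u ^ L u)"

definition incr :: "nat \<Rightarrow> (nat \<Rightarrow> nat) \<Rightarrow> nat \<Rightarrow> nat" where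
  "incr t L = L(t := Suc (L t))"

definition decr :: "nat \<Rightarrow> (nat \<Rightarrow> nat) \<Rightarrow> nat \<Rightarrow> nat" where
  "decr t L = L(t := L t - 1)"

lemma decr_incr [simp]: "decr t (incr t L) = L"
  by (simp add: incr_def decr_def)

lemma incr_decr [simp]: "L t > 0 \<Longrightarrow> incr t (decr t L) = L"
  by (simp add: incr_def decr_def fun_eq_iff)

lemma incr_pos [simp]: "incr t L t > 0"
  by (simp add: incr_def)

lemma mi_deg_superset:
  "finite S \<Longrightarrow> {j. L j \<noteq> 0} \<subseteq> S \<Longrightarrow> mi_deg L = (\<Sum>j\<in>S. j * L j)"
  unfolding mi_deg_def by (rule sum.mono_neutral_left) auto

lemma mi_size_superset:
  "finite S \<Longrightarrow> {j. L j \<noteq> 0} \<subseteq> S \<Longrightarrow> mi_size L = (\<Sum>j\<in>S. L j)"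
  unfolding mi_size_def by (rule sum.mono_neutral_left) auto

lemma centralizer_superset:
  "finite S \<Longrightarrow> {j. L j \<noteq> 0} \<subseteq> S \<Longrightarrow> centralizer L = (\<Prod>u\<in>S. fact (L u) * real u ^ L u)"
  unfolding centralizer_def by (rule prod.mono_neutral_left) auto

lemma multi_index_incr: "t \<ge> 1 \<Longrightarrow> multi_index (incr t L) \<longleftrightarrow> multi_index L"
proof -
  have "{j. (incr t L) j \<noteq> 0} = insert t {j. L j \<noteq> 0}" by (auto simp: incr_def)
  thus "t \<ge> 1 \<Longrightarrow> multi_index (incr t L) \<longleftrightarrow> multi_index L"
    by (auto simp: multi_index_def incr_def)
qed

lemma incr_stats:
  assumes "multi_index L" "t \<ge> 1"
  shows "mi_deg (incr t L) = mi_deg L + t" "mi_size (incr t L) = Suc (mi_size L)"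
    "centralizer (incr t L) = real t * real (Suc (L t)) * centralizer L"
proof -
  define S where "S = insert t {j. L j \<noteq> 0}"
  have S: "finite S" "t \<in> S" "{j. L j \<noteq> 0} \<subseteq> S" "{j. incr t L j \<noteq> 0} \<subseteq> S"
    using assms by (auto simp: S_def multi_index_def incr_def)
  have off: "incr t L j = L j" if "j \<in> S - {t}" for j using that by (auto simp: incr_def)
  have on: "incr t L t = Suc (L t)" by (simp add: incr_def)
  show "mi_deg (incr t L) = mi_deg L + t"
    unfolding mi_deg_superset[OF S(1,3)] mi_deg_superset[OF S(1,4)] sum.remove[OF S(1,2)]
    by (simp add: off on)
  show "mi_size (incr t L) = Suc (mi_size L)"
    unfolding mi_size_superset[OF S(1,3)] mi_size_superset[OF S(1,4)] sum.remove[OF S(1,2)]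
    by (simp add: off on)
  show "centralizer (incr t L) = real t * real (Suc (L t)) * centralizer L"
    unfolding centralizer_superset[OF S(1,3)] centralizer_superset[OF S(1,4)] prod.remove[OF S(1,2)]
    by (simp add: off on)
qed

lemma partitions_bound:
  assumes "L \<in> partitions d" "L t > 0"
  shows "1 \<le> t" "t \<le> d" "L t \<le> d"
proof -
  have mi: "multi_index L" "mi_deg L = d" using assms by (auto simp: partitions_def)
  show "1 \<le> t" using mi assms(2) by (cases t) (auto simp: multi_index_def)
  have "t * L t \<le> d"
    using mi assms(2) member_le_sum[of t "{j. L j \<noteq> 0}" "\<lambda>j. j * L j"]
    by (auto simp: mi_deg_def multi_index_def)
  moreover have "t \<le> t * L t" "L t \<le> t * L t" using assms(2) \<open>1 \<le> t\<close> by auto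
  ultimately show "t \<le> d" "L t \<le> d" by linarith+
qed

lemma finite_partitions: "finite (partitions d)"
proof (rule finite_subset)
  show "partitions d \<subseteq> {f. \<forall>x. (x \<in> {..d} \<longrightarrow> f x \<in> {..d}) \<and> (x \<notin> {..d} \<longrightarrow> f x = 0)}"
  proof (intro subsetI CollectI allI conjI impI)
    fix L x assume L: "L \<in> partitions d"
    show "L x \<in> {..d}" using partitions_bound(3)[OF L, of x] by (cases "L x > 0") auto
    show "L x = 0" if "x \<notin> {..d}" using partitions_bound(2)[OF L, of x] that by (cases "L x > 0") auto
  qed
  show "finite {f. \<forall>x. (x \<in> {..d} \<longrightarrow> f x \<in> {..d}) \<and> (x \<notin> {..d} \<longrightarrow> f x = (0::nat))}"
    by (rule finite_set_of_finite_funs) auto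
qed

lemma partitions_0: "partitions 0 = {\<lambda>_. 0}"
proof -
  have "L = (\<lambda>_. 0)" if "L \<in> partitions 0" for L
  proof
    fix t show "L t = 0" using partitions_bound[OF that, of t] by (cases "L t > 0") auto
  qed
  moreover have "(\<lambda>_. 0) \<in> partitions 0" by (simp add: partitions_def multi_index_def mi_deg_def)
  ultimately show ?thesis by blast
qed

lemma incr_partitions:
  "t \<ge> 1 \<Longrightarrow> t \<le> d \<Longrightarrow> L \<in> partitions (d - t) \<Longrightarrow> incr t L \<in> partitions d"
  by (auto simp: partitions_def multi_index_incr incr_stats)

lemma decr_partitions:
  assumes "L \<in> partitions d" "L t > 0"
  shows "decr t L \<in> partitions (d - t)"
proof -
  have t: "t \<ge> 1" using partitions_bound(1)[OF assms] .
  have "multi_index (incr t (decr t L))" "mi_deg (incr t (decr t L)) = d"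
    using assms by (auto simp: partitions_def)
  thus ?thesis
    using t incr_stats(1)[of "decr t L" t] by (auto simp: partitions_def multi_index_incr)
qed

lemma centralizer_pos: "L \<in> partitions d \<Longrightarrow> centralizer L > 0"
  unfolding centralizer_def
proof (intro prod_pos ballI)
  fix u assume L: "L \<in> partitions d" and "u \<in> {u. L u \<noteq> 0}"
  hence "u \<ge> 1" using partitions_bound(1)[OF L, of u] by simp
  thus "0 < fact (L u) * real u ^ L u" by simp
qed

lemma sum_partitions_reindex:
  assumes "t \<ge> 1" "t \<le> d"
  shows "(\<Sum>L\<in>partitions d. if L t > 0 then g L else (0::real)) = (\<Sum>L\<in>partitions (d - t). g (incr t L))"
proof -
  have "(\<Sum>L\<in>partitions d. if L t > 0 then g L else 0) = (\<Sum>L\<in>{L\<in>partitions d. L t > 0}. g L)"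
    by (simp add: sum.inter_filter finite_partitions)
  also have "\<dots> = (\<Sum>L\<in>partitions (d - t). g (incr t L))"
    by (rule sum.reindex_bij_witness[of _ "incr t" "decr t"])
       (use assms incr_partitions decr_partitions in \<open>auto simp: incr_pos\<close>)
  finally show ?thesis .
qed

text \<open>Adding a part t multiplies z_L by t (L(t) + 1), so the weight t L(t) is absorbed when
  one part t is removed.\<close>

lemma sum_partitions_marked:
  assumes "t \<ge> 1" "t \<le> d"
  shows "(\<Sum>L\<in>partitions d. real (t * L t) / centralizer L * g L) =
    (\<Sum>L\<in>partitions (d - t). g (incr t L) / centralizer L)"
proof -
  have "(\<Sum>L\<in>partitions d. real (t * L t) / centralizer L * g L) =
     (\<Sum>L\<in>partitions d. if L t > 0 then real (t * L t) / centralizer L * g L else 0)"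
    by (rule sum.cong) auto
  also have "\<dots> = (\<Sum>L\<in>partitions (d - t). real (t * incr t L t) / centralizer (incr t L) * g (incr t L))"
    by (rule sum_partitions_reindex[OF assms])
  also have "\<dots> = (\<Sum>L\<in>partitions (d - t). g (incr t L) / centralizer L)"
  proof (rule sum.cong)
    fix L assume "L \<in> partitions (d - t)"
    hence "multi_index L" by (simp add: partitions_def)
    moreover have "incr t L t = Suc (L t)" by (simp add: incr_def)
    ultimately show "real (t * incr t L t) / centralizer (incr t L) * g (incr t L) = g (incr t L) / centralizer L"
      using assms(1) by (simp add: incr_stats del: of_nat_Suc mult_Suc_right)
  qed simp
  finally show ?thesis .
qed

section \<open>Coefficients in the power sums\<close>

definition families :: "'a set \<Rightarrow> ('a \<Rightarrow> nat) \<Rightarrow> (nat \<Rightarrow> nat) \<Rightarrow> ('a \<Rightarrow> nat \<Rightarrow> nat) set" where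
  "families I \<nu> L = {J \<in> (\<Pi>\<^sub>E i\<in>I. partitions (\<nu> i)). (\<lambda>u. \<Sum>i\<in>I. J i u) = L}"

text \<open>The coefficient of the power sum product \<open>p\<^sub>L\<close> in the product of the complete homogeneous
  symmetric functions \<open>h\<close> of degrees \<open>\<nu> i\<close>.\<close>
definition hcoeff :: "'a set \<Rightarrow> ('a \<Rightarrow> nat) \<Rightarrow> (nat \<Rightarrow> nat) \<Rightarrow> real" where
  "hcoeff I \<nu> L = (\<Sum>J\<in>families I \<nu> L. \<Prod>i\<in>I. 1 / centralizer (J i))"

lemma finite_families: "finite I \<Longrightarrow> finite (families I \<nu> L)"
  unfolding families_def
  by (rule finite_subset[of _ "\<Pi>\<^sub>E i\<in>I. partitions (\<nu> i)"]) (auto intro!: finite_PiE finite_partitions)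

lemma families_sum: "J \<in> families I \<nu> L \<Longrightarrow> L u = (\<Sum>i\<in>I. J i u)"
  by (auto simp: families_def)

text \<open>A part t of \<open>J x\<close> is marked and removed, the weight t J_x(t) being absorbed
  by the centralizer. Summing over t for fixed x, or over x for fixed t, gives the two recursions
  below.\<close>

lemma hcoeff_marked:
  assumes fin: "finite I" and x: "x \<in> I" and t: "t \<ge> 1"
  shows "(\<Sum>J\<in>families I \<nu> L. real (t * J x t) * (\<Prod>i\<in>I. 1 / centralizer (J i))) =
    (if t \<le> \<nu> x \<and> L t > 0 then hcoeff I (\<nu>(x := \<nu> x - t)) (decr t L) else 0)"
proof (cases "t \<le> \<nu> x \<and> L t > 0")
  case True
  let ?F = "families I \<nu> L" and ?G = "families I (\<nu>(x := \<nu> x - t)) (decr t L)"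
  have "(\<Sum>J\<in>?F. real (t * J x t) * (\<Prod>i\<in>I. 1 / centralizer (J i))) =
    (\<Sum>J\<in>{J\<in>?F. J x t > 0}. real (t * J x t) * (\<Prod>i\<in>I. 1 / centralizer (J i)))"
    by (rule sum.mono_neutral_right) (auto simp: finite_families fin)
  also have "\<dots> = (\<Sum>J\<in>?G. \<Prod>i\<in>I. 1 / centralizer (J i))"
  proof (rule sum.reindex_bij_witness[of _ "\<lambda>J. J(x := incr t (J x))" "\<lambda>J. J(x := decr t (J x))"])
    fix J assume "J \<in> {J\<in>?F. J x t > 0}"
    hence J: "J \<in> (\<Pi>\<^sub>E i\<in>I. partitions (\<nu> i))" "\<And>u. (\<Sum>i\<in>I. J i u) = L u" and pos: "J x t > 0"
      by (auto simp: families_def fun_eq_iff)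
    have Jx: "J x \<in> partitions (\<nu> x)" using J x by auto
    show "(J(x := decr t (J x)))(x := incr t ((J(x := decr t (J x))) x)) = J"
      using pos by (simp add: fun_eq_iff)
    have "J(x := decr t (J x)) \<in> (\<Pi>\<^sub>E i\<in>I. partitions ((\<nu>(x := \<nu> x - t)) i))"
      using J(1) x decr_partitions[OF Jx pos] by (auto simp: PiE_iff extensional_def)
    moreover have "(\<Sum>i\<in>I. (J(x := decr t (J x))) i u) = decr t L u" for u
    proof -
      have "(\<Sum>i\<in>I. (J(x := decr t (J x))) i u) = decr t (J x) u + (\<Sum>i\<in>I - {x}. J i u)"
        by (subst sum.remove[OF fin x]) (auto intro!: sum.cong)
      also have "\<dots> = decr t L u"
        using J(2)[of u, symmetric] pos unfolding sum.remove[OF fin x] by (auto simp: decr_def)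
      finally show ?thesis .
    qed
    ultimately show "J(x := decr t (J x)) \<in> ?G" by (auto simp: families_def)
    have "real (t * J x t) / centralizer (J x) = 1 / centralizer (decr t (J x))"
    proof -
      have "centralizer (J x) = real t * real (J x t) * centralizer (decr t (J x))"
        using incr_stats(3)[of "decr t (J x)" t] decr_partitions[OF Jx pos] t pos
        by (simp add: partitions_def) (simp add: decr_def)
      thus ?thesis using t pos by simp
    qed
    moreover have "(\<Prod>i\<in>I - {x}. 1 / centralizer ((J(x := decr t (J x))) i)) = (\<Prod>i\<in>I - {x}. 1 / centralizer (J i))"
      by (rule prod.cong) auto
    ultimately show "(\<Prod>i\<in>I. 1 / centralizer ((J(x := decr t (J x))) i)) =
        real (t * J x t) * (\<Prod>i\<in>I. 1 / centralizer (J i))"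
      unfolding prod.remove[OF fin x]
      by (simp only: fun_upd_same mult.assoc[symmetric] times_divide_eq_right mult_1_right)
  next
    fix J assume "J \<in> ?G"
    hence J: "J \<in> (\<Pi>\<^sub>E i\<in>I. partitions ((\<nu>(x := \<nu> x - t)) i))" "\<And>u. (\<Sum>i\<in>I. J i u) = decr t L u"
      by (auto simp: families_def fun_eq_iff)
    have Jx: "J x \<in> partitions (\<nu> x - t)" using PiE_mem[OF J(1) x] by simp
    show "(J(x := incr t (J x)))(x := decr t ((J(x := incr t (J x))) x)) = J"
      by (simp add: fun_eq_iff)
    have "J i \<in> partitions (\<nu> i)" if "i \<in> I" "i \<noteq> x" for i using PiE_mem[OF J(1) that(1)] that(2) by simp
    hence "J(x := incr t (J x)) \<in> (\<Pi>\<^sub>E i\<in>I. partitions (\<nu> i))"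
      using J(1) x incr_partitions[OF t _ Jx] True by (auto simp: PiE_iff extensional_def)
    moreover have "(\<Sum>i\<in>I. (J(x := incr t (J x))) i u) = L u" for u
    proof -
      have "(\<Sum>i\<in>I. (J(x := incr t (J x))) i u) = incr t (J x) u + (\<Sum>i\<in>I - {x}. J i u)"
        by (subst sum.remove[OF fin x]) (auto intro!: sum.cong)
      also have "\<dots> = L u"
        using J(2)[of u] True unfolding sum.remove[OF fin x]
        by (auto simp: decr_def incr_def split: if_splits)
      finally show ?thesis .
    qed
    ultimately show "J(x := incr t (J x)) \<in> {J\<in>?F. J x t > 0}"
      by (auto simp: families_def incr_def)
  qed
  finally show ?thesis using True by (simp add: hcoeff_def)
next
  case False
  have "J x t = 0" if "J \<in> families I \<nu> L" for J
  proof (rule ccontr)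
    assume *: "J x t \<noteq> 0"
    have Jx: "J x \<in> partitions (\<nu> x)" using that x by (auto simp: families_def)
    have "t \<le> \<nu> x" using partitions_bound(2)[OF Jx, of t] * by simp
    moreover have "L t > 0"
      unfolding families_sum[OF that, of t] using * x fin by (intro sum_pos2[of _ x]) auto
    ultimately show False using False by simp
  qed
  thus ?thesis unfolding if_not_P[OF False] by (intro sum.neutral ballI) simp
qed

text \<open>This is n h_n = sum of p_t h_(n-t) read off at p_L; it holds because the parts of
  \<open>J x\<close> add up to \<open>\<nu> x\<close>.\<close>

lemma hcoeff_recursion:
  assumes "finite I" "x \<in> I"
  shows "real (\<nu> x) * hcoeff I \<nu> L =
    (\<Sum>t<\<nu> x. if L (Suc t) > 0 then hcoeff I (\<nu>(x := \<nu> x - Suc t)) (decr (Suc t) L) else 0)"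
proof -
  have deg: "(\<Sum>t<\<nu> x. real (Suc t * J x (Suc t))) = real (\<nu> x)" if "J \<in> families I \<nu> L" for J
  proof -
    have Jx: "J x \<in> partitions (\<nu> x)" using that assms by (auto simp: families_def)
    have "real (\<nu> x) = real (mi_deg (J x))" using Jx by (simp add: partitions_def)
    also have "mi_deg (J x) = (\<Sum>j\<in>Suc ` {..<\<nu> x}. j * J x j)"
    proof (rule mi_deg_superset)
      show "{j. J x j \<noteq> 0} \<subseteq> Suc ` {..<\<nu> x}"
        using partitions_bound[OF Jx] by (auto simp: image_Suc_lessThan)
    qed simp
    also have "\<dots> = (\<Sum>t<\<nu> x. Suc t * J x (Suc t))" by (simp add: sum.reindex)
    finally show ?thesis by simp
  qed
  have "real (\<nu> x) * hcoeff I \<nu> L = (\<Sum>J\<in>families I \<nu> L. \<Sum>t<\<nu> x. real (Suc t * J x (Suc t)) * (\<Prod>i\<in>I. 1 / centralizer (J i)))"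
    unfolding hcoeff_def sum_distrib_left sum_distrib_right[symmetric] 
    by (intro sum.cong refl) (simp only: deg)
  also have "\<dots> = (\<Sum>t<\<nu> x. \<Sum>J\<in>families I \<nu> L. real (Suc t * J x (Suc t)) * (\<Prod>i\<in>I. 1 / centralizer (J i)))"
    by (rule sum.swap)
  also have "\<dots> = (\<Sum>t<\<nu> x. if L (Suc t) > 0 then hcoeff I (\<nu>(x := \<nu> x - Suc t)) (decr (Suc t) L) else 0)"
    by (intro sum.cong refl, subst hcoeff_marked) (use assms in auto)
  finally show ?thesis .
qed

text \<open>This is the derivation t d/dp_t, which sends h_n to h_(n-t); it holds because the parts
  t of all \<open>J x\<close> together number \<open>L t\<close>.\<close>

lemma hcoeff_adjoint:
  assumes "finite I" "t \<ge> 1" "L t > 0"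
  shows "real (t * L t) * hcoeff I \<nu> L =
    (\<Sum>x\<in>I. if t \<le> \<nu> x then hcoeff I (\<nu>(x := \<nu> x - t)) (decr t L) else 0)"
proof -
  have "real (t * L t) * hcoeff I \<nu> L =
     (\<Sum>J\<in>families I \<nu> L. \<Sum>x\<in>I. real (t * J x t) * (\<Prod>i\<in>I. 1 / centralizer (J i)))"
    unfolding hcoeff_def sum_distrib_left sum_distrib_right[symmetric]
    by (intro sum.cong refl) (simp add: families_sum[of _ I \<nu> L t] sum_distrib_left)
  also have "\<dots> = (\<Sum>x\<in>I. \<Sum>J\<in>families I \<nu> L. real (t * J x t) * (\<Prod>i\<in>I. 1 / centralizer (J i)))"
    by (rule sum.swap)
  also have "\<dots> = (\<Sum>x\<in>I. if t \<le> \<nu> x then hcoeff I (\<nu>(x := \<nu> x - t)) (decr t L) else 0)"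
    by (intro sum.cong refl, subst hcoeff_marked) (use assms in auto)
  finally show ?thesis .
qed

section \<open>The scalar product and its recursion\<close>

text \<open>The pairing of products of complete homogeneous symmetric functions for the scalar product in
  which \<open>p\<^sub>L\<close> has square norm \<open>centralizer L / \<beta>^|L|\<close>.\<close>
definition hpair :: "real \<Rightarrow> nat \<Rightarrow> 'a set \<Rightarrow> 'b set \<Rightarrow> ('a \<Rightarrow> nat) \<Rightarrow> ('b \<Rightarrow> nat) \<Rightarrow> real" where
  "hpair \<beta> d I K \<nu> \<mu> = (\<Sum>L\<in>partitions d. hcoeff I \<nu> L * hcoeff K \<mu> L * centralizer L / \<beta> ^ mi_size L)"

text \<open>One left factor is expanded by n h_n = sum of p_t h_(n-t), and p_t is moved to the right
  as its adjoint (t/\<beta>) d/dp_t, which acts on each right factor in turn. The result is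
  \<open>corr_recursion\<close> without the \<open>edge\<close> terms.\<close>

lemma hpair_recursion:
  assumes fin: "finite I" "finite K" and x: "x \<in> I" and d: "\<nu> x \<le> d" and \<beta>: "\<beta> > 0"
  shows "\<beta> * real (\<nu> x) * hpair \<beta> d I K \<nu> \<mu> =
    (\<Sum>k\<in>K. \<Sum>t<min (\<nu> x) (\<mu> k). hpair \<beta> (d - Suc t) I K (\<nu>(x := \<nu> x - Suc t)) (\<mu>(k := \<mu> k - Suc t)))"
proof -
  have "\<beta> * real (\<nu> x) * hpair \<beta> d I K \<nu> \<mu> =
    (\<Sum>L\<in>partitions d. (real (\<nu> x) * hcoeff I \<nu> L) * (\<beta> * hcoeff K \<mu> L * centralizer L / \<beta> ^ mi_size L))"
    by (simp add: hpair_def sum_distrib_left mult_ac)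
  also have "\<dots> = (\<Sum>L\<in>partitions d. \<Sum>t<\<nu> x. if L (Suc t) > 0 then
        hcoeff I (\<nu>(x := \<nu> x - Suc t)) (decr (Suc t) L) * (\<beta> * hcoeff K \<mu> L * centralizer L / \<beta> ^ mi_size L) else 0)"
    unfolding hcoeff_recursion[OF fin(1) x] sum_distrib_right by (intro sum.cong refl) auto
  also have "\<dots> = (\<Sum>t<\<nu> x. \<Sum>L\<in>partitions d. if L (Suc t) > 0 then
        hcoeff I (\<nu>(x := \<nu> x - Suc t)) (decr (Suc t) L) * (\<beta> * hcoeff K \<mu> L * centralizer L / \<beta> ^ mi_size L) else 0)"
    by (rule sum.swap)
  also have "\<dots> = (\<Sum>t<\<nu> x. \<Sum>k\<in>K. if Suc t \<le> \<mu> k then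
      hpair \<beta> (d - Suc t) I K (\<nu>(x := \<nu> x - Suc t)) (\<mu>(k := \<mu> k - Suc t)) else 0)"
  proof (intro sum.cong refl)
    fix t assume t: "t \<in> {..<\<nu> x}"
    define s where "s = Suc t"
    have s: "s \<ge> 1" "s \<le> d" using t d by (auto simp: s_def)
    let ?\<nu> = "\<nu>(x := \<nu> x - s)"
    have "(\<Sum>L\<in>partitions d. if L s > 0 then
        hcoeff I ?\<nu> (decr s L) * (\<beta> * hcoeff K \<mu> L * centralizer L / \<beta> ^ mi_size L) else 0) =
      (\<Sum>L\<in>partitions (d - s). hcoeff I ?\<nu> L * (\<beta> * hcoeff K \<mu> (incr s L) * centralizer (incr s L) / \<beta> ^ mi_size (incr s L)))"
      by (subst sum_partitions_reindex[OF s]) simp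
    \<comment> \<open>Adding the part s multiplies the centralizer by s (L(s) + 1), which is what
      the derivation requires, and the power of \<beta> by \<beta>, which cancels the
      prefactor.\<close>
    also have "\<dots> = (\<Sum>L\<in>partitions (d - s). hcoeff I ?\<nu> L * 
       (\<Sum>k\<in>K. if s \<le> \<mu> k then hcoeff K (\<mu>(k := \<mu> k - s)) L else 0) * centralizer L / \<beta> ^ mi_size L)"
    proof (intro sum.cong refl)
      fix L assume "L \<in> partitions (d - s)"
      hence mi: "multi_index L" by (simp add: partitions_def)
      have inc: "incr s L s = Suc (L s)" by (simp add: incr_def)
      have "real (s * Suc (L s)) * hcoeff K \<mu> (incr s L) =
        (\<Sum>k\<in>K. if s \<le> \<mu> k then hcoeff K (\<mu>(k := \<mu> k - s)) L else 0)"
        using hcoeff_adjoint[OF fin(2) s(1), of "incr s L" \<mu>] unfolding inc decr_incr by simp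
      from this[symmetric] show "hcoeff I ?\<nu> L * (\<beta> * hcoeff K \<mu> (incr s L) * centralizer (incr s L) / \<beta> ^ mi_size (incr s L))
        = hcoeff I ?\<nu> L * (\<Sum>k\<in>K. if s \<le> \<mu> k then hcoeff K (\<mu>(k := \<mu> k - s)) L else 0) * centralizer L / \<beta> ^ mi_size L"
        using \<beta> by (simp add: incr_stats[OF mi s(1)] mult_ac del: mult_Suc_right of_nat_Suc)
    qed
    also have "\<dots> = (\<Sum>L\<in>partitions (d - s). \<Sum>k\<in>K. if s \<le> \<mu> k then
        hcoeff I ?\<nu> L * hcoeff K (\<mu>(k := \<mu> k - s)) L * centralizer L / \<beta> ^ mi_size L else 0)"
      unfolding sum_distrib_left sum_distrib_right sum_divide_distrib by (intro sum.cong refl) auto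
    also have "\<dots> = (\<Sum>k\<in>K. \<Sum>L\<in>partitions (d - s). if s \<le> \<mu> k then
        hcoeff I ?\<nu> L * hcoeff K (\<mu>(k := \<mu> k - s)) L * centralizer L / \<beta> ^ mi_size L else 0)"
      by (rule sum.swap)
    also have "\<dots> = (\<Sum>k\<in>K. if s \<le> \<mu> k then hpair \<beta> (d - s) I K ?\<nu> (\<mu>(k := \<mu> k - s)) else 0)"
      by (intro sum.cong refl) (simp add: hpair_def)
    finally show "(\<Sum>L\<in>partitions d. if L (Suc t) > 0 then
        hcoeff I (\<nu>(x := \<nu> x - Suc t)) (decr (Suc t) L) * (\<beta> * hcoeff K \<mu> L * centralizer L / \<beta> ^ mi_size L) else 0) =
      (\<Sum>k\<in>K. if Suc t \<le> \<mu> k then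
      hpair \<beta> (d - Suc t) I K (\<nu>(x := \<nu> x - Suc t)) (\<mu>(k := \<mu> k - Suc t)) else 0)"
      by (simp only: s_def)
  qed
  also have "\<dots> = (\<Sum>k\<in>K. \<Sum>t<\<nu> x. if Suc t \<le> \<mu> k then
      hpair \<beta> (d - Suc t) I K (\<nu>(x := \<nu> x - Suc t)) (\<mu>(k := \<mu> k - Suc t)) else 0)"
    by (rule sum.swap)
  also have "\<dots> = (\<Sum>k\<in>K. \<Sum>t<min (\<nu> x) (\<mu> k). hpair \<beta> (d - Suc t) I K (\<nu>(x := \<nu> x - Suc t)) (\<mu>(k := \<mu> k - Suc t)))"
    by (intro sum.cong refl sum.mono_neutral_cong_right) auto
  finally show ?thesis .
qed

lemma hcoeff_0:
  assumes "finite I" "\<And>i. i \<in> I \<Longrightarrow> \<nu> i = 0"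
  shows "hcoeff I \<nu> (\<lambda>_. 0) = 1"
proof -
  have "(\<Pi>\<^sub>E i\<in>I. partitions (\<nu> i)) = (\<Pi>\<^sub>E i\<in>I. {\<lambda>_. 0})"
    using assms by (intro PiE_cong) (simp add: partitions_0)
  hence "families I \<nu> (\<lambda>_. 0) = {\<lambda>i\<in>I. (\<lambda>_. 0)}"
    by (auto simp: families_def PiE_singleton fun_eq_iff)
  thus ?thesis by (simp add: hcoeff_def centralizer_def)
qed

section \<open>Cycle types of permutations\<close>

text \<open>The cycle type over an arbitrary ground set, so that points can be added by
  induction.\<close>

definition orbit_count :: "'a set \<Rightarrow> ('a \<Rightarrow> 'a) \<Rightarrow> nat \<Rightarrow> nat" where
  "orbit_count S \<pi> u = card {X \<in> orbit \<pi> ` S. card X = u}"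

text \<open>The transposition inserts a into the cycle of b just before b: the old preimage of b now
  maps to a, and a maps to b.\<close>

lemma orbit_comp_transpose:
  assumes p: "p permutes S" and fin: "finite S" and a: "a \<notin> S" and b: "b \<in> S"
  defines "q \<equiv> Transposition.transpose a b \<circ> p"
  shows "orbit q b = insert a (orbit p b)" "orbit q a = orbit q b"
    "\<And>z. z \<in> S \<Longrightarrow> orbit q z = (if z \<in> orbit p b then orbit q b else orbit p z)"
proof -
  have pp: "permutation p" using p fin permutation_permutes by blast
  have "q permutes insert a S"
    unfolding q_def using permutes_subset[OF p, of "insert a S"] a b
    by (intro permutes_compose) (auto intro: permutes_swap_id)
  hence qq: "permutation q" using fin permutation_permutes by blast
  have ab: "a \<noteq> b" using a b by auto
  have qa: "q a = b" using a p by (simp add: q_def permutes_not_in)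
  have qz: "q z = (if p z = b then a else p z)" if "z \<in> S" for z
    using permutes_in_image[OF p, of z] that a by (auto simp: q_def Transposition.transpose_def)
  have sub: "orbit p z \<subseteq> S" if "z \<in> S" for z by (rule permutes_orbit_subset[OF p that])
  have bp: "b \<in> orbit p b" by (rule permutation_self_in_orbit[OF pp])
  have bq: "b \<in> orbit q b" by (rule permutation_self_in_orbit[OF qq])
  have step: "p y \<in> orbit q b" if "y \<in> orbit q b" "y \<in> S" for y
    using that orbit.step[of y q b] bq by (cases "p y = b") (auto simp: qz)
  have fwd: "y \<in> orbit q b" if "y \<in> orbit p b" for y
    using that
  proof (induction rule: orbit.induct)
    case base
    show ?case by (rule step[OF bq b])
  next
    case (step z)
    show ?case by (rule \<open>\<And>y. y \<in> orbit q b \<Longrightarrow> y \<in> S \<Longrightarrow> p y \<in> orbit q b\<close>) (use step sub[OF b] in auto)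
  qed
  obtain y where y: "y \<in> orbit p b" "p y = b"
    using bp by (cases rule: orbit.cases) (metis bp, metis)
  have "q y = a" using y sub[OF b] by (auto simp: qz)
  hence aq: "a \<in> orbit q b" using orbit.step[OF fwd[OF y(1)]] by simp
  have bwd: "y \<in> insert a (orbit p b)" if "y \<in> orbit q b" for y
    using that
  proof (induction rule: orbit.induct)
    case base
    show ?case using b by (auto simp: qz orbit.base)
  next
    case (step y)
    show ?case
    proof (cases "y = a")
      case False
      hence y: "y \<in> orbit p b" using step by simp
      hence "y \<in> S" using sub[OF b] by blast
      thus ?thesis using orbit.step[OF y] by (simp add: qz)
    qed (simp add: qa bp)
  qed
  show eq: "orbit q b = insert a (orbit p b)" using fwd bwd aq by blast
  have same: "orbit q z = orbit q b" if "z \<in> orbit q b" for z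
    by (rule orbit_cyclic_eq3[OF cyclic_on_orbit'[OF qq] that])
  show "orbit q a = orbit q b" by (rule same[OF aq])
  fix z assume z: "z \<in> S"
  show "orbit q z = (if z \<in> orbit p b then orbit q b else orbit p z)"
  proof (cases "z \<in> orbit p b")
    case True
    thus ?thesis using same[of z] eq by simp
  next
    case False
    have nb: "b \<notin> orbit p z"
    proof
      assume "b \<in> orbit p z"
      hence "orbit p b = orbit p z" by (rule orbit_cyclic_eq3[OF cyclic_on_orbit'[OF pp]])
      thus False using False permutation_self_in_orbit[OF pp] by metis
    qed
    have "orbit q z = orbit p z"
    proof (rule orbit_cong)
      show "z \<in> orbit p z" by (rule permutation_self_in_orbit[OF pp])
      fix s assume s: "s \<in> orbit p z"
      hence "p s \<noteq> b" using nb orbit.step[OF s] by auto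
      thus "q s = p s" using s sub[OF z] by (auto simp: qz)
    qed
    thus ?thesis using False by simp
  qed
qed

lemma orbit_count_insert_fixed:
  assumes p: "p permutes S" and fin: "finite S" and a: "a \<notin> S"
  shows "orbit_count (insert a S) p = incr 1 (orbit_count S p)"
proof
  fix u
  have "orbit p a = {a}" using p a by (simp add: orbit_eq_singleton_iff permutes_not_in)
  hence eq: "orbit p ` insert a S = insert {a} (orbit p ` S)" by simp
  have new: "{a} \<notin> orbit p ` S" using permutes_orbit_subset[OF p] a by blast
  show "orbit_count (insert a S) p u = incr 1 (orbit_count S p) u"
  proof (cases "u = 1")
    case True
    have "{X \<in> orbit p ` insert a S. card X = u} = insert {a} {X \<in> orbit p ` S. card X = u}"
      unfolding eq using True by auto
    thus ?thesis using new fin True by (simp add: orbit_count_def incr_def)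
  next
    case False
    hence "{X \<in> orbit p ` insert a S. card X = u} = {X \<in> orbit p ` S. card X = u}"
      unfolding eq by auto
    thus ?thesis using False by (simp add: orbit_count_def incr_def)
  qed
qed

lemma orbit_count_comp_transpose:
  assumes p: "p permutes S" and fin: "finite S" and a: "a \<notin> S" and b: "b \<in> S"
  defines "u \<equiv> card (orbit p b)"
  shows "orbit_count (insert a S) (Transposition.transpose a b \<circ> p) = incr (Suc u) (decr u (orbit_count S p))"
proof -
  define q where "q = Transposition.transpose a b \<circ> p"
  note orb = orbit_comp_transpose[OF p fin a b, folded q_def]
  have pp: "permutation p" using p fin permutation_permutes by blast
  have sub: "orbit p z \<subseteq> S" if "z \<in> S" for z by (rule permutes_orbit_subset[OF p that])
  define C where "C = orbit p b"
  \<comment> \<open>\<open>R\<close> holds the cycles avoiding b; the cycles before and after the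
    insertion are \<open>R\<close> together with one more.\<close>
  define R where "R = orbit p ` S - {C}"
  have finC: "finite C" using sub[OF b] fin by (auto simp: C_def intro: finite_subset)
  have aC: "a \<notin> C" using sub[OF b] a by (auto simp: C_def)
  have mem: "z \<in> C \<longleftrightarrow> orbit p z = C" for z
    using orbit_cyclic_eq3[OF cyclic_on_orbit'[OF pp], of z b] permutation_self_in_orbit[OF pp, of z]
    by (auto simp: C_def)
  have q_img: "orbit q ` insert a S = insert (insert a C) R"
  proof -
    have "orbit q ` S = insert (insert a C) R"
    proof (intro equalityI subsetI)
      fix X assume "X \<in> orbit q ` S"
      then obtain z where "z \<in> S" "X = orbit q z" by auto
      thus "X \<in> insert (insert a C) R" using orb(1) orb(3)[of z] mem[of z] by (auto simp: R_def C_def[symmetric])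
    next
      fix X assume X: "X \<in> insert (insert a C) R"
      show "X \<in> orbit q ` S"
      proof (cases "X = insert a C")
        case True
        thus ?thesis using orb(1) b by (auto simp: C_def)
      next
        case False
        then obtain z where "z \<in> S" "X = orbit p z" "orbit p z \<noteq> C" using X by (auto simp: R_def)
        thus ?thesis using orb(3)[of z] mem[of z] by (auto simp: C_def[symmetric] intro!: image_eqI[of _ _ z])
      qed
    qed
    thus ?thesis using orb(1,2) by (auto simp: C_def)
  qed
  have p_img: "orbit p ` S = insert C R" using b by (auto simp: R_def C_def)
  have newC: "C \<notin> R" and newaC: "insert a C \<notin> R"
    using sub a by (auto simp: R_def)
  have finR: "finite R" using fin by (simp add: R_def)
  define r where "r v = card {X \<in> R. card X = v}" for v
  have cnt: "card {X \<in> insert Y R. card X = v} = r v + (if card Y = v then 1 else 0)" if "Y \<notin> R" for Y v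
  proof (cases "card Y = v")
    case True
    hence "{X \<in> insert Y R. card X = v} = insert Y {X \<in> R. card X = v}" by auto
    thus ?thesis using that finR True by (simp add: r_def)
  next
    case False
    hence "{X \<in> insert Y R. card X = v} = {X \<in> R. card X = v}" by auto
    thus ?thesis using False by (simp add: r_def)
  qed
  have card: "card (insert a C) = Suc u" "card C = u" using finC aC by (auto simp: u_def C_def)
  have "orbit_count (insert a S) q = (\<lambda>v. r v + (if Suc u = v then 1 else 0))"
    by (simp only: orbit_count_def[abs_def] q_img cnt[OF newaC] card)
  moreover have "orbit_count S p = (\<lambda>v. r v + (if u = v then 1 else 0))"
    by (simp only: orbit_count_def[abs_def] p_img cnt[OF newC] card)
  ultimately show ?thesis by (auto simp: q_def incr_def decr_def)
qed

text \<open>Grouping the points by their cycle, each cycle of length u is counted u times.\<close>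

lemma sum_over_orbits:
  assumes p: "p permutes S" and fin: "finite S"
  shows "(\<Sum>b\<in>S. h (card (orbit p b))) = (\<Sum>u=1..card S. real (u * orbit_count S p u) * h u)"
proof -
  have pp: "permutation p" using p fin permutation_permutes by blast
  have sub: "orbit p z \<subseteq> S" if "z \<in> S" for z by (rule permutes_orbit_subset[OF p that])
  let ?O = "orbit p ` S"
  have fib: "{b \<in> S. orbit p b = X} = X" if X: "X \<in> ?O" for X
  proof -
    from X obtain z where z: "z \<in> S" "X = orbit p z" by auto
    have "b \<in> X" if "orbit p b = X" for b using that permutation_self_in_orbit[OF pp, of b] by simp
    moreover have "orbit p b = X" if "b \<in> X" for b
      using that unfolding z(2) by (rule orbit_cyclic_eq3[OF cyclic_on_orbit'[OF pp]])
    moreover have "X \<subseteq> S" unfolding z(2) by (rule sub[OF z(1)])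
    ultimately show ?thesis by blast
  qed
  have "(\<Sum>b\<in>S. h (card (orbit p b))) = (\<Sum>X\<in>?O. \<Sum>b\<in>{b\<in>S. orbit p b = X}. h (card (orbit p b)))"
    using sum.image_gen[OF fin, of "\<lambda>b. h (card (orbit p b))" "orbit p"] by simp
  also have "\<dots> = (\<Sum>X\<in>?O. real (card X) * h (card X))"
  proof (rule sum.cong)
    fix X assume X: "X \<in> ?O"
    have "(\<Sum>b\<in>{b\<in>S. orbit p b = X}. h (card (orbit p b))) = (\<Sum>b\<in>{b\<in>S. orbit p b = X}. h (card X))"
      by (rule sum.cong) auto
    thus "(\<Sum>b\<in>{b\<in>S. orbit p b = X}. h (card (orbit p b))) = real (card X) * h (card X)"
      by (simp add: fib[OF X])
  qed simp
  also have "\<dots> = (\<Sum>u\<in>{1..card S}. \<Sum>X\<in>{X\<in>?O. card X = u}. real (card X) * h (card X))"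
  proof (rule sum.group[symmetric])
    show "card ` ?O \<subseteq> {1..card S}"
    proof
      fix u assume "u \<in> card ` ?O"
      then obtain z where z: "z \<in> S" "u = card (orbit p z)" by auto
      have "u \<le> card S" unfolding z(2) by (rule card_mono[OF fin sub[OF z(1)]])
      moreover have "u > 0" using z sub[OF z(1)] fin orbit_nonempty[of p z]
        by (simp add: card_gt_0_iff finite_subset)
      ultimately show "u \<in> {1..card S}" by simp
    qed
  qed (use fin in auto)
  also have "\<dots> = (\<Sum>u=1..card S. real (u * orbit_count S p u) * h u)"
    by (intro sum.cong refl) (simp add: orbit_count_def)
  finally show ?thesis .
qed

text \<open>Permutations are built by inserting a new point either as a fixed point or into the cycle of an old point.\<close>
lemma sum_permutations_cycle_type:
  fixes \<phi> :: "(nat \<Rightarrow> nat) \<Rightarrow> real"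
  assumes "finite S"
  shows "(\<Sum>p | p permutes S. \<phi> (orbit_count S p)) =
    fact (card S) * (\<Sum>L\<in>partitions (card S). \<phi> L / centralizer L)"
  using assms
proof (induction S arbitrary: \<phi> rule: finite_induct)
  case empty
  have "orbit_count {} p = (\<lambda>_. 0)" for p :: "'a \<Rightarrow> 'a" by (simp add: orbit_count_def fun_eq_iff)
  thus ?case by (simp add: partitions_0 centralizer_def)
next
  case (insert a S)
  let ?d = "card S"
  \<comment> \<open>\<open>\<psi> L\<close> sums \<phi> over all insertions of one point: as a fixed
    point, or before one of the \<open>u * L u\<close> points in cycles of length u. The fixed point
    is the choice b = a below.\<close>
  define \<psi> where "\<psi> L = \<phi> (incr 1 L) + (\<Sum>u=1..?d. real (u * L u) * \<phi> (incr (Suc u) (decr u L)))" for L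
  have "(\<Sum>p | p permutes insert a S. \<phi> (orbit_count (insert a S) p)) =
     (\<Sum>b\<in>insert a S. \<Sum>p | p permutes S. \<phi> (orbit_count (insert a S) (Transposition.transpose a b \<circ> p)))"
    using insert by (subst sum_over_permutations_insert) auto
  also have "\<dots> = (\<Sum>p | p permutes S. \<Sum>b\<in>insert a S. \<phi> (orbit_count (insert a S) (Transposition.transpose a b \<circ> p)))"
    by (rule sum.swap)
  also have "\<dots> = (\<Sum>p | p permutes S. \<psi> (orbit_count S p))"
  proof (intro sum.cong refl)
    fix p assume "p \<in> {p. p permutes S}"
    hence p: "p permutes S" by simp
    have "(\<Sum>b\<in>insert a S. \<phi> (orbit_count (insert a S) (Transposition.transpose a b \<circ> p))) =
      \<phi> (incr 1 (orbit_count S p)) +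
      (\<Sum>b\<in>S. \<phi> (incr (Suc (card (orbit p b))) (decr (card (orbit p b)) (orbit_count S p))))"
      using insert.hyps orbit_count_insert_fixed[OF p insert.hyps]
        orbit_count_comp_transpose[OF p insert.hyps] by simp
    also have "\<dots> = \<psi> (orbit_count S p)"
      unfolding \<psi>_def by (subst sum_over_orbits[OF p insert.hyps(1)]) simp
    finally show "(\<Sum>b\<in>insert a S. \<phi> (orbit_count (insert a S) (Transposition.transpose a b \<circ> p))) = \<psi> (orbit_count S p)" .
  qed
  also have "\<dots> = fact ?d * (\<Sum>L\<in>partitions ?d. \<psi> L / centralizer L)"
    by (rule insert.IH)
  also have "(\<Sum>L\<in>partitions ?d. \<psi> L / centralizer L) = (\<Sum>L\<in>partitions ?d. \<phi> (incr 1 L) / centralizer L) +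
     (\<Sum>L\<in>partitions ?d. \<Sum>u=1..?d. real (u * L u) / centralizer L * \<phi> (incr (Suc u) (decr u L)))"
    unfolding \<psi>_def add_divide_distrib sum.distrib sum_divide_distrib
    by (simp add: mult_ac)
  also have "(\<Sum>L\<in>partitions ?d. \<Sum>u=1..?d. real (u * L u) / centralizer L * \<phi> (incr (Suc u) (decr u L))) =
     (\<Sum>u=1..?d. \<Sum>L\<in>partitions ?d. real (u * L u) / centralizer L * \<phi> (incr (Suc u) (decr u L)))"
    by (rule sum.swap)
  also have "\<dots> = (\<Sum>u=1..?d. \<Sum>L\<in>partitions (?d - u). \<phi> (incr (Suc u) L) / centralizer L)"
  proof (rule sum.cong[OF refl])
    fix u assume "u \<in> {1..?d}"
    thus "(\<Sum>L\<in>partitions ?d. real (u * L u) / centralizer L * \<phi> (incr (Suc u) (decr u L))) =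
      (\<Sum>L\<in>partitions (?d - u). \<phi> (incr (Suc u) L) / centralizer L)"
      using sum_partitions_marked[of u ?d "\<lambda>L. \<phi> (incr (Suc u) (decr u L))"] by simp
  qed
  \<comment> \<open>A new fixed point is the case u = 0 of a cycle growing from u to u + 1.\<close>
  also have "(\<Sum>L\<in>partitions ?d. \<phi> (incr 1 L) / centralizer L) + \<dots> =
     (\<Sum>u=0..?d. \<Sum>L\<in>partitions (?d - u). \<phi> (incr (Suc u) L) / centralizer L)"
    by (simp add: sum.atLeast_Suc_atMost)
  also have "\<dots> = (\<Sum>t=1..Suc ?d. \<Sum>L\<in>partitions (Suc ?d - t). \<phi> (incr t L) / centralizer L)"
    by (simp only: One_nat_def sum.shift_bounds_cl_Suc_ivl diff_Suc_Suc)
  \<comment> \<open>The marking is now read backwards: each L of degree d + 1 receives total weight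
    sum of t L(t) = d + 1, which turns d! into (d + 1)!.\<close>
  also have "\<dots> = (\<Sum>t=1..Suc ?d. \<Sum>L\<in>partitions (Suc ?d). real (t * L t) / centralizer L * \<phi> L)"
    by (rule sum.cong[OF refl], rule sum_partitions_marked[symmetric]) auto
  also have "\<dots> = (\<Sum>L\<in>partitions (Suc ?d). \<Sum>t=1..Suc ?d. real (t * L t) / centralizer L * \<phi> L)"
    by (rule sum.swap)
  also have "\<dots> = (\<Sum>L\<in>partitions (Suc ?d). real (Suc ?d) * (\<phi> L / centralizer L))"
  proof (intro sum.cong refl)
    fix L assume L: "L \<in> partitions (Suc ?d)"
    have "(\<Sum>t=1..Suc ?d. t * L t) = mi_deg L"
    proof (rule mi_deg_superset[symmetric])
      show "{j. L j \<noteq> 0} \<subseteq> {1..Suc ?d}" using partitions_bound[OF L] by auto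
    qed simp
    hence "(\<Sum>t=1..Suc ?d. real (t * L t)) = real (Suc ?d)"
      using L by (simp only: of_nat_sum[symmetric]) (simp add: partitions_def)
    thus "(\<Sum>t=1..Suc ?d. real (t * L t) / centralizer L * \<phi> L) = real (Suc ?d) * (\<phi> L / centralizer L)"
      by (simp only: sum_distrib_right[symmetric] sum_divide_distrib[symmetric] times_divide_eq_left times_divide_eq_right)
  qed
  finally show ?case
    using insert.hyps by (simp add: sum_distrib_left mult_ac del: of_nat_Suc) 
qed

lemma expectation_partition_pmf:
  fixes \<phi> :: "(nat \<Rightarrow> nat) \<Rightarrow> real"
  shows "measure_pmf.expectation (partition_pmf d) \<phi> = (\<Sum>L\<in>partitions d. \<phi> L / centralizer L)"
proof -
  have fin: "finite {p. p permutes {1..d}}" by (simp add: finite_permutations)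
  have ne: "{p. p permutes {1..d}} \<noteq> {}" using permutes_id by blast
  have "measure_pmf.expectation (partition_pmf d) \<phi> =
     (\<Sum>p | p permutes {1..d}. \<phi> (cycle_type d p)) / real (card {p. p permutes {1..d}})"
    unfolding partition_pmf_def integral_map_pmf by (rule integral_pmf_of_set[OF ne fin])
  also have "card {p. p permutes {1..d}} = fact d"
    by (rule card_permutations) auto
  also have "(\<Sum>p | p permutes {1..d}. \<phi> (cycle_type d p)) = (\<Sum>p | p permutes {1..d}. \<phi> (orbit_count {1..d} p))"
    by (simp add: cycle_type_def orbit_count_def[abs_def])
  also have "\<dots> = fact d * (\<Sum>L\<in>partitions d. \<phi> L / centralizer L)"
    by (subst sum_permutations_cycle_type) auto
  finally show ?thesis by simp
qed

section \<open>The limit\<close>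

lemma pos_pol_fwd:
  assumes "\<And>j. pos_pol (x j) \<and> pos_pol (y j)"
  shows "pos_pol (coeff (fwdA x y n) c)" "pos_pol (coeff (fwdD x y n) c)"
proof -
  have "(\<forall>c. pos_pol (coeff (fwdA x y n) c)) \<and> (\<forall>c. pos_pol (coeff (fwdD x y n) c))"
    by (induction n) (auto simp: coeff_pCons one_pCons split: nat.splits
        intro!: pos_pol_add pos_pol_mult simp: assms)
  thus "pos_pol (coeff (fwdA x y n) c)" "pos_pol (coeff (fwdD x y n) c)" by auto
qed

lemma pos_pol_vars [simp]: "pos_pol (varX n)" "pos_pol (varY n)"
  by (simp_all add: varX_def varY_def)

lemma pos_pol_prod_diff:
  assumes "finite S" "\<And>i. i \<in> S \<Longrightarrow> pos_pol (f i) \<and> pos_pol (g i)"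
  shows "pos_pol ((\<Prod>i\<in>S. f i + g i) - (\<Prod>i\<in>S. f i))"
  using assms
proof (induction S rule: finite_induct)
  case (insert j S)
  have "(\<Prod>i\<in>insert j S. f i + g i) - (\<Prod>i\<in>insert j S. f i) =
     (f j + g j) * ((\<Prod>i\<in>S. f i + g i) - (\<Prod>i\<in>S. f i)) + g j * (\<Prod>i\<in>S. f i)"
    using insert.hyps by (simp add: algebra_simps)
  also have "pos_pol \<dots>" using insert by (auto intro!: pos_pol_add pos_pol_mult pos_pol_prod)
  finally show ?case .
qed simp

text \<open>In the expansion of A_(M+1) = A_M + x_M D_M and of its conjugate every term has
  nonnegative coefficients. The retained term contains level M only through x_M y_M, of mean
  1/(M\<beta>+1), times the integrand of \<open>edge\<close>.\<close>

lemma corr_increment: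
  assumes \<beta>: "\<beta> \<ge> 0" and fin: "finite I" "finite K" and i0: "i0 \<in> I" and k0: "k0 \<in> K"
  shows "edge \<beta> M I K i0 k0 \<nu> \<mu> / (real M * \<beta> + 1) \<le> corr \<beta> (Suc M) I K \<nu> \<mu> - corr \<beta> M I K \<nu> \<mu>"
    and "edge \<beta> M I K i0 k0 \<nu> \<mu> \<ge> 0"
proof -
  have pos: "pos_pol (hA n c)" "pos_pol (aA n c)" "pos_pol (hD n c)" "pos_pol (aD n c)" for n c
    using pos_pol_fwd[of varX varY] pos_pol_fwd[of varY varX] by auto
  define H where "H n = (\<Prod>i\<in>I - {i0}. hA n (\<nu> i))" for n
  define A where "A n = (\<Prod>k\<in>K - {k0}. aA n (\<mu> k))" for n
  have posHA: "pos_pol (H n)" "pos_pol (A n)" for n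
    unfolding H_def A_def by (auto intro!: pos_pol_prod pos)
  have dH: "pos_pol (H (Suc M) - H M)" and dA: "pos_pol (A (Suc M) - A M)"
    unfolding H_def A_def fwdA.simps coeff_add
    by (rule pos_pol_prod_diff; use fin in \<open>auto intro!: pos pos_pol_mult\<close>)+
  define a e b f where "a = hA M (\<nu> i0)" and "e = varX M * hD M (\<nu> i0)"
    and "b = aA M (\<mu> k0)" and "f = varY M * aD M (\<mu> k0)"
  have p4: "pos_pol a" "pos_pol e" "pos_pol b" "pos_pol f"
    unfolding a_def e_def b_def f_def by (auto intro!: pos pos_pol_mult)
  have c1: "corr \<beta> (Suc M) I K \<nu> \<mu> = expct \<beta> (((a + e) * H (Suc M)) * ((b + f) * A (Suc M)))"
    unfolding corr_def prod.remove[OF fin(1) i0] prod.remove[OF fin(2) k0] H_def A_def a_def b_def e_def f_def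
    by simp
  have c0: "corr \<beta> M I K \<nu> \<mu> = expct \<beta> ((a * H M) * (b * A M))"
    unfolding corr_def prod.remove[OF fin(1) i0] prod.remove[OF fin(2) k0] H_def A_def a_def b_def
    by simp
  let ?h = "hD M (\<nu> i0) * aD M (\<mu> k0) * (H M * A M)"
  have XY: "free M (varX j) \<and> free M (varY j)" "free M (varY j) \<and> free M (varX j)" if "j \<noteq> M" for j
    using that by (auto intro: free_varX free_varY)
  have "free M ?h"
    unfolding H_def A_def
    using freeP_fwd[of M varX varY M, OF XY(1)] freeP_fwd[of M varY varX M, OF XY(2)]
    by (auto simp: freeP_def intro!: free_mult free_prod)
  from expct_varX_varY[OF this, of \<beta>]
  have ed: "edge \<beta> M I K i0 k0 \<nu> \<mu> / (real M * \<beta> + 1) = expct \<beta> (e * f * (H M * A M))"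
    by (simp add: edge_def H_def A_def e_def f_def mult_ac)
  have "((a + e) * H (Suc M)) * ((b + f) * A (Suc M)) - (a * H M) * (b * A M) - e * f * (H M * A M) =
    (a * b + e * f) * ((H (Suc M) - H M) * A (Suc M) + H M * (A (Suc M) - A M)) +
    (a * f + e * b) * (H (Suc M) * A (Suc M))"
    by (simp add: algebra_simps)
  also have "pos_pol \<dots>"
    by (intro pos_pol_add pos_pol_mult p4 dH dA posHA)
  finally have "expct \<beta> (((a + e) * H (Suc M)) * ((b + f) * A (Suc M)) - (a * H M) * (b * A M) - e * f * (H M * A M)) \<ge> 0"
    by (rule expct_nonneg[OF \<beta>])
  thus "edge \<beta> M I K i0 k0 \<nu> \<mu> / (real M * \<beta> + 1) \<le> corr \<beta> (Suc M) I K \<nu> \<mu> - corr \<beta> M I K \<nu> \<mu>"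
    unfolding c1 c0 ed expct_diff by simp
  show "edge \<beta> M I K i0 k0 \<nu> \<mu> \<ge> 0"
    unfolding edge_def by (intro expct_nonneg[OF \<beta>] pos_pol_mult pos pos_pol_prod)
qed

lemma incseq_corr:
  assumes \<beta>: "\<beta> \<ge> 0" and fin: "finite I" "finite K"
  shows "incseq (\<lambda>M. corr \<beta> M I K \<nu> \<mu>)"
proof (rule incseq_SucI)
  fix M
  have pos: "pos_pol (hA n c)" "pos_pol (aA n c)" "pos_pol (hD n c)" "pos_pol (aD n c)" for n c
    using pos_pol_fwd[of varX varY] pos_pol_fwd[of varY varX] by auto
  define H where "H n = (\<Prod>i\<in>I. hA n (\<nu> i))" for n
  define A where "A n = (\<Prod>k\<in>K. aA n (\<mu> k))" for n
  have posHA: "pos_pol (H n)" "pos_pol (A n)" for n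
    unfolding H_def A_def by (auto intro!: pos_pol_prod pos)
  have dH: "pos_pol (H (Suc M) - H M)" and dA: "pos_pol (A (Suc M) - A M)"
    unfolding H_def A_def fwdA.simps coeff_add
    by (rule pos_pol_prod_diff; use fin in \<open>auto intro!: pos pos_pol_mult\<close>)+
  have "H (Suc M) * A (Suc M) - H M * A M = (H (Suc M) - H M) * A (Suc M) + H M * (A (Suc M) - A M)"
    by (simp add: algebra_simps)
  also have "pos_pol \<dots>" by (intro pos_pol_add pos_pol_mult dH dA posHA)
  finally have "expct \<beta> (H (Suc M) * A (Suc M) - H M * A M) \<ge> 0" by (rule expct_nonneg[OF \<beta>])
  thus "corr \<beta> M I K \<nu> \<mu> \<le> corr \<beta> (Suc M) I K \<nu> \<mu>"
    by (simp add: corr_def H_def A_def expct_diff)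
qed

section \<open>Vanishing of the error and passage to the limit\<close>

lemma limit_nonpos_of_telescoping_bound:
  fixes e B :: "nat \<Rightarrow> real"
  assumes \<beta>: "\<beta> > 0" and lim: "e \<longlonglongrightarrow> l" and B: "convergent B"
    and le: "\<And>M. e M / (real M * \<beta> + 1) \<le> B (Suc M) - B M"
  shows "l \<le> 0"
proof (rule ccontr)
  assume "\<not> l \<le> 0"
  hence l: "l > 0" by simp
  hence "\<forall>\<^sub>F M in sequentially. e M > l / 2" using lim by (intro order_tendstoD) auto
  moreover from B obtain b where "B \<longlonglongrightarrow> b" by (auto simp: convergent_def)
  hence sB: "summable (\<lambda>M. B (Suc M) - B M)" by (rule telescope_summable)
  \<comment> \<open>With l positive, the summable increments of \<open>B\<close> eventually dominate
    a positive multiple of the harmonic series.\<close>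
  ultimately have "summable (\<lambda>M. (l / 2) / ((\<beta> + 1) * real (Suc M)))"
  proof (elim summable_comparison_test_ev[rotated])
    assume "\<forall>\<^sub>F M in sequentially. e M > l / 2"
    thus "\<forall>\<^sub>F M in sequentially. norm ((l / 2) / ((\<beta> + 1) * real (Suc M))) \<le> B (Suc M) - B M"
    proof eventually_elim
      case (elim M)
      have "real M * \<beta> + 1 \<le> (\<beta> + 1) * real (Suc M)" using \<beta> by (simp add: algebra_simps)
      hence "(l / 2) / ((\<beta> + 1) * real (Suc M)) \<le> e M / (real M * \<beta> + 1)"
        using elim l \<beta> by (intro frac_le) (auto intro: add_nonneg_pos)
      thus ?case using le[of M] l \<beta> by simp
    qed
  qed
  hence "summable (\<lambda>M. (l / (2 * (\<beta> + 1))) * inverse (real (Suc M)))"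
    by (simp add: field_simps)
  hence "summable (\<lambda>M. inverse (real (Suc M)))"
    by (subst (asm) summable_cmult_iff) (use l \<beta> in auto)
  thus False using not_summable_harmonic[where 'a=real] by (subst (asm) summable_Suc_iff) simp
qed

lemma coeff_fwdA_0: "coeff (fwdA x y n) 0 = 1"
proof -
  have "coeff (fwdD x y n) 0 = 0" for n by (cases n) auto
  thus ?thesis by (induction n) auto
qed

text \<open>Strong induction on the degree: once the error vanishes in the limit,
  \<open>corr\<close> and \<open>hpair\<close> obey the same recursion, and
  \<open>\<beta> * real (\<nu> i0)\<close> is nonzero.\<close>

theorem corr_tendsto:
  assumes \<beta>: "\<beta> > 0" and fin: "finite I" "finite K" and "sum \<nu> I = d" "sum \<mu> K = d"
  shows "(\<lambda>M. corr \<beta> M I K \<nu> \<mu>) \<longlonglongrightarrow> hpair \<beta> d I K \<nu> \<mu>"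
  using assms(4,5)
proof (induction d arbitrary: \<nu> \<mu> rule: less_induct)
  case (less d)
  show ?case
  proof (cases "d = 0")
    case True
    hence z: "\<And>i. i \<in> I \<Longrightarrow> \<nu> i = 0" "\<And>k. k \<in> K \<Longrightarrow> \<mu> k = 0"
      using less.prems fin by auto
    have "corr \<beta> M I K \<nu> \<mu> = 1" for M
      using expct_mpmono[of \<beta> "({#}, {#})"]
      by (simp add: corr_def z coeff_fwdA_0 mpmono_0 mono_wt_def cong: prod.cong)
    moreover have "hpair \<beta> d I K \<nu> \<mu> = 1"
      using hcoeff_0[OF fin(1), of \<nu>] hcoeff_0[OF fin(2), of \<mu>] z
      by (simp add: hpair_def True partitions_0 centralizer_def mi_size_def)
    ultimately show ?thesis by simp
  next
    case False
    then obtain i0 where i0: "i0 \<in> I" "\<nu> i0 > 0" using less.prems by (metis neq0_conv sum.neutral)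
    define m where "m k = min (\<nu> i0) (\<mu> k)" for k
    define c where "c M k t = corr \<beta> M I K (\<nu>(i0 := \<nu> i0 - t)) (\<mu>(k := \<mu> k - t))" for M k t
    define e where "e M k t = edge \<beta> M I K i0 k (\<nu>(i0 := \<nu> i0 - t)) (\<mu>(k := \<mu> k - t))" for M k t
    define h where "h k t = hpair \<beta> (d - t) I K (\<nu>(i0 := \<nu> i0 - t)) (\<mu>(k := \<mu> k - t))" for k t
    have clim: "(\<lambda>M. c M k (Suc t)) \<longlonglongrightarrow> h k (Suc t)" if "k \<in> K" "t < m k" for k t
    proof -
      have t: "Suc t \<le> \<nu> i0" "Suc t \<le> \<mu> k" using that by (auto simp: m_def)
      have upd: "sum (f(x := f x - Suc t)) S = sum f S - Suc t"
        if "finite S" "x \<in> S" "Suc t \<le> f x" for f :: "'x \<Rightarrow> nat" and x S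
      proof -
        have "sum (f(x := f x - Suc t)) S = (f x - Suc t) + sum f (S - {x})"
          unfolding sum.remove[OF that(1,2)] by (auto intro!: sum.cong)
        thus ?thesis using that(3) sum.remove[OF that(1,2), of f] by simp
      qed
      have "d - Suc t < d" using False by simp
      thus ?thesis unfolding c_def h_def
        by (rule less.IH) (use upd[of I i0 \<nu>] upd[of K k \<mu>] fin i0 t that less.prems in auto)
    qed
    \<comment> \<open>\<open>T\<close> contains only shifts by at least one, whose limits are known
      by induction; \<open>Er\<close> is the total error.\<close>
    define T where "T M = (\<Sum>k\<in>K. \<Sum>t<m k. c M k (Suc t))" for M
    define Er where "Er M = (\<Sum>k\<in>K. \<Sum>t\<le>m k. e M k t)" for M
    have Tlim: "T \<longlonglongrightarrow> (\<Sum>k\<in>K. \<Sum>t<m k. h k (Suc t))"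
      unfolding T_def by (intro tendsto_sum clim) auto
    have Er_nonneg: "Er M \<ge> 0" for M
      unfolding Er_def e_def using \<beta> by (intro sum_nonneg corr_increment(2) fin i0) auto
    have rec: "\<beta> * real (\<nu> i0) * corr \<beta> M I K \<nu> \<mu> = T M - Er M" if "M > 0" for M
      using corr_recursion[OF _ fin i0(1) that, of \<beta> \<nu> \<mu>] \<beta>
      by (simp add: T_def Er_def c_def e_def m_def sum_subtractf)
    have \<beta>\<nu>: "\<beta> * real (\<nu> i0) > 0" using \<beta> i0 by simp
    \<comment> \<open>As the error is nonnegative, the convergent \<open>T\<close> bounds the
      increasing correlations, so a limit v exists before its value is known.\<close>
    have inc: "incseq (\<lambda>M. corr \<beta> M I K \<nu> \<mu>)" using \<beta> by (intro incseq_corr fin) auto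
    obtain C where C: "\<And>M. T M \<le> C"
      using convergent_imp_Bseq[OF convergentI[OF Tlim]] unfolding Bseq_def
      by (metis abs_le_D1 real_norm_def)
    have "corr \<beta> M I K \<nu> \<mu> \<le> C / (\<beta> * real (\<nu> i0))" for M
    proof -
      \<comment> \<open>Passing to \<open>Suc M\<close> includes M = 0, where \<open>rec\<close>
        does not apply.\<close>
      have "corr \<beta> M I K \<nu> \<mu> \<le> corr \<beta> (Suc M) I K \<nu> \<mu>" using inc by (auto simp: incseq_Suc_iff)
      moreover have "\<beta> * real (\<nu> i0) * corr \<beta> (Suc M) I K \<nu> \<mu> \<le> C"
        using rec[of "Suc M"] Er_nonneg[of "Suc M"] C[of "Suc M"] by simp
      ultimately show ?thesis using \<beta>\<nu> by (simp add: pos_le_divide_eq mult.commute order_trans)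
    qed
    then obtain v where v: "(\<lambda>M. corr \<beta> M I K \<nu> \<mu>) \<longlonglongrightarrow> v"
      using incseq_convergent[OF inc] by metis
    define l where "l = (\<Sum>k\<in>K. \<Sum>t<m k. h k (Suc t)) - \<beta> * real (\<nu> i0) * v"
    have "(\<lambda>M. T M - \<beta> * real (\<nu> i0) * corr \<beta> M I K \<nu> \<mu>) \<longlonglongrightarrow> l"
      unfolding l_def by (intro tendsto_diff Tlim tendsto_mult v tendsto_const)
    moreover have "\<forall>\<^sub>F M in sequentially. T M - \<beta> * real (\<nu> i0) * corr \<beta> M I K \<nu> \<mu> = Er M"
      using eventually_gt_at_top[of 0] by eventually_elim (simp add: rec)
    ultimately have Erlim: "Er \<longlonglongrightarrow> l" by (rule Lim_transform_eventually)
    \<comment> \<open>The term t = 0 of \<open>B\<close> is the correlation itself, whose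
      convergence to v has just been obtained; the increments of \<open>B\<close> dominate the error
      divided by M\<beta>+1.\<close>
    define B where "B M = (\<Sum>k\<in>K. \<Sum>t\<le>m k. c M k t)" for M
    have "convergent B"
    proof -
      have "convergent (\<lambda>M. c M k t)" if "k \<in> K" "t \<le> m k" for k t
      proof (cases t)
        case 0
        thus ?thesis using v by (auto simp: c_def convergent_def)
      next
        case (Suc s)
        thus ?thesis using clim[of k s] that by (auto simp: convergent_def)
      qed
      thus ?thesis unfolding B_def by (intro convergent_sum) auto
    qed
    moreover have "Er M / (real M * \<beta> + 1) \<le> B (Suc M) - B M" for M
    proof -
      have "Er M / (real M * \<beta> + 1) = (\<Sum>k\<in>K. \<Sum>t\<le>m k. e M k t / (real M * \<beta> + 1))"
        by (simp add: Er_def sum_divide_distrib)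
      also have "\<dots> \<le> (\<Sum>k\<in>K. \<Sum>t\<le>m k. c (Suc M) k t - c M k t)"
        unfolding e_def c_def using \<beta> by (intro sum_mono corr_increment(1) fin i0) auto
      finally show ?thesis by (simp add: B_def sum_subtractf)
    qed
    ultimately have "l \<le> 0" by (intro limit_nonpos_of_telescoping_bound[OF \<beta> Erlim])
    moreover have "l \<ge> 0" by (rule LIMSEQ_le_const[OF Erlim]) (use Er_nonneg in auto)
    ultimately have "\<beta> * real (\<nu> i0) * v = (\<Sum>k\<in>K. \<Sum>t<m k. h k (Suc t))"
      by (simp add: l_def)
    also have "\<dots> = \<beta> * real (\<nu> i0) * hpair \<beta> d I K \<nu> \<mu>"
      unfolding h_def m_def
      by (rule hpair_recursion[symmetric, OF fin i0(1) _ \<beta>])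
         (use member_le_sum[of i0 I \<nu>] i0 fin less.prems in auto)
    finally have "v = hpair \<beta> d I K \<nu> \<mu>" using \<beta>\<nu> \<beta> i0 by simp
    thus ?thesis using v by simp
  qed
qed

section \<open>Interlaced words\<close>

definition words :: "nat \<Rightarrow> nat \<Rightarrow> (nat list \<times> nat list) set" where
  "words M c = {(i, j). interlaced c i j \<and> set i \<subseteq> {..<M} \<and> set j \<subseteq> {..<M}}"

text \<open>The first upper letter M is prescribed but omitted: these are the words of D_M, whose
  missing x_M is supplied by the next transfer step.\<close>

definition open_words :: "nat \<Rightarrow> nat \<Rightarrow> (nat list \<times> nat list) set" where
  "open_words M c = {(i, j). interlaced c (M # i) j}"

lemma interlaced_Nil: "interlaced c [] j \<longleftrightarrow> j = [] \<and> c = 0"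
  by (auto simp: interlaced_def)

lemma interlaced_Nil2: "interlaced c i [] \<longleftrightarrow> i = [] \<and> c = 0"
  by (auto simp: interlaced_def)

lemma interlaced_Cons:
  "interlaced c (a # i) (b # j) \<longleftrightarrow>
    b < a \<and> (i \<noteq> [] \<longrightarrow> hd i < b) \<and> (\<exists>c'. c = (a - b) + c' \<and> interlaced c' i j)"
proof -
  have "interlaced c (a # i) (b # j) \<longleftrightarrow> length i = length j \<and> b < a \<and> (\<forall>u<length i. j ! u < i ! u) \<and>
     (i \<noteq> [] \<longrightarrow> hd i < b) \<and> (\<forall>u. Suc u < length i \<longrightarrow> i ! Suc u < j ! u) \<and>
     (a - b) + (\<Sum>u<length i. i ! u - j ! u) = c"
    unfolding interlaced_def list.size(4) sum.lessThan_Suc_shift add_Suc_right add_0_right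
    by (auto simp: All_less_Suc2 nth_Cons hd_conv_nth less_Suc_eq_0_disj split: nat.splits)
  thus ?thesis by (auto simp: interlaced_def)
qed

lemma interlaced_ConsE:
  assumes "interlaced c (a # i) j"
  obtains b j' c' where "j = b # j'" "b < a" "i \<noteq> [] \<longrightarrow> hd i < b" "c = (a - b) + c'" "interlaced c' i j'"
proof (cases j)
  case Nil
  thus ?thesis using assms by (simp add: interlaced_Nil2)
next
  case (Cons b j')
  with assms have "interlaced c (a # i) (b # j')" by simp
  thus ?thesis using that[OF Cons] unfolding interlaced_Cons by blast
qed

lemma interlaced_bound:
  "interlaced c i j \<Longrightarrow> (i \<noteq> [] \<longrightarrow> hd i < M) \<Longrightarrow> set i \<subseteq> {..<M} \<and> set j \<subseteq> {..<M}"
proof (induction i arbitrary: c j M)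
  case (Cons a i)
  from Cons.prems(1) obtain b j' c' where *: "j = b # j'" "b < a" "i \<noteq> [] \<longrightarrow> hd i < b" "interlaced c' i j'"
    by (rule interlaced_ConsE)
  have "set i \<subseteq> {..<b} \<and> set j' \<subseteq> {..<b}" by (rule Cons.IH[OF *(4)]) (use *(3) in auto)
  thus ?case using * Cons.prems by fastforce
qed (simp add: interlaced_Nil)

text \<open>The letters decrease strictly, so only the first upper one has to be bounded.\<close>

lemma words_altdef: "words M c = {(i, j). interlaced c i j \<and> (i \<noteq> [] \<longrightarrow> hd i < M)}"
proof -
  have "hd i < M" if "set i \<subseteq> {..<M}" "i \<noteq> []" for i using that by (cases i) auto
  thus ?thesis using interlaced_bound unfolding words_def by blast
qed

lemma words_0: "words 0 c = (if c = 0 then {([], [])} else {})"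
  by (auto simp: words_def interlaced_Nil interlaced_Nil2)

lemma open_words_0: "open_words 0 c = {}"
  by (auto simp: open_words_def elim: interlaced_ConsE)

text \<open>The combinatorial form of A_(M+1) = A_M + x_M D_M: the first upper letter is below M or
  equal to M.\<close>

lemma words_Suc: "words (Suc M) c = words M c \<union> (\<lambda>(i, j). (M # i, j)) ` open_words M c"
proof (intro equalityI subsetI)
  fix w assume "w \<in> words (Suc M) c"
  then obtain i j where w: "w = (i, j)" "interlaced c i j" "i \<noteq> [] \<longrightarrow> hd i < Suc M"
    by (auto simp: words_altdef)
  show "w \<in> words M c \<union> (\<lambda>(i, j). (M # i, j)) ` open_words M c"
  proof (cases "i \<noteq> [] \<longrightarrow> hd i < M")
    case False
    then obtain i' where "i = M # i'" using w by (cases i) auto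
    thus ?thesis using w by (auto simp: open_words_def intro!: rev_image_eqI[of "(i', j)"])
  qed (use w in \<open>auto simp: words_altdef\<close>)
qed (auto simp: words_altdef open_words_def)

lemma open_words_Suc_0: "open_words (Suc M) 0 = {}"
  by (auto simp: open_words_def elim!: interlaced_ConsE)

text \<open>The combinatorial form of D_(M+1) = z (y_M A_M + D_M). Either the first lower letter is
  M, a gap of one, or it is smaller, and lowering the omitted letter from M + 1 to M reduces the
  weight by one.\<close>

lemma open_words_Suc_Suc:
  "open_words (Suc M) (Suc c) = (\<lambda>(i, j). (i, M # j)) ` words M c \<union> open_words M c"
proof (intro equalityI subsetI)
  fix w assume "w \<in> open_words (Suc M) (Suc c)"
  then obtain i j where w: "w = (i, j)" "interlaced (Suc c) (Suc M # i) j" by (auto simp: open_words_def)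
  from w(2) obtain b j' c' where *: "j = b # j'" "b < Suc M" "i \<noteq> [] \<longrightarrow> hd i < b"
      "Suc c = (Suc M - b) + c'" "interlaced c' i j'"
    by (rule interlaced_ConsE)
  show "w \<in> (\<lambda>(i, j). (i, M # j)) ` words M c \<union> open_words M c"
  proof (cases "b = M")
    case True
    hence "(i, j') \<in> words M c" using * by (auto simp: words_altdef)
    thus ?thesis using w * True by force
  next
    case False
    hence "b < M" "c = (M - b) + c'" using * by auto
    hence "interlaced c (M # i) (b # j')" unfolding interlaced_Cons using * by blast
    thus ?thesis using w * by (simp add: open_words_def)
  qed
next
  fix w assume "w \<in> (\<lambda>(i, j). (i, M # j)) ` words M c \<union> open_words M c"
  thus "w \<in> open_words (Suc M) (Suc c)"
  proof
    assume "w \<in> open_words M c"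
    then obtain i j where w: "w = (i, j)" "interlaced c (M # i) j" by (auto simp: open_words_def)
    from w(2) obtain b j' c' where *: "j = b # j'" "b < M" "i \<noteq> [] \<longrightarrow> hd i < b"
        "c = (M - b) + c'" "interlaced c' i j'"
      by (rule interlaced_ConsE)
    have "Suc c = (Suc M - b) + c'" using * by simp
    hence "interlaced (Suc c) (Suc M # i) (b # j')" unfolding interlaced_Cons using * by auto
    thus ?thesis using w * by (simp add: open_words_def)
  next
    assume "w \<in> (\<lambda>(i, j). (i, M # j)) ` words M c"
    thus ?thesis by (auto simp: words_altdef open_words_def interlaced_Cons)
  qed
qed

lemma open_words_hd: "(i, j) \<in> open_words M c \<Longrightarrow> j \<noteq> [] \<and> hd j < M"
  by (auto simp: open_words_def elim!: interlaced_ConsE)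

lemma finite_words: "finite (words M c)" and finite_open_words: "finite (open_words M c)"
proof -
  have "(\<forall>c. finite (words M c)) \<and> (\<forall>c. finite (open_words M c))"
  proof (induction M)
    case (Suc M)
    have "finite (open_words (Suc M) c)" for c
      using Suc by (cases c) (auto simp: open_words_Suc_0 open_words_Suc_Suc)
    thus ?case using Suc by (auto simp: words_Suc)
  qed (auto simp: words_0 open_words_0)
  thus "finite (words M c)" "finite (open_words M c)" by auto
qed

section \<open>Coefficients and correlations as sums over words\<close>

definition word_prod :: "(nat \<Rightarrow> 'r) \<Rightarrow> (nat \<Rightarrow> 'r) \<Rightarrow> nat list \<times> nat list \<Rightarrow> 'r::comm_ring_1" where
  "word_prod x y w = prod_list (map x (fst w)) * prod_list (map y (snd w))"

lemma coeff_fwd_words: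
  "coeff (fwdA x y M) c = (\<Sum>w\<in>words M c. word_prod x y w)"
  "coeff (fwdD x y M) c = (\<Sum>w\<in>open_words M c. word_prod x y w)"
proof -
  have "(\<forall>c. coeff (fwdA x y M) c = (\<Sum>w\<in>words M c. word_prod x y w)) \<and>
    (\<forall>c. coeff (fwdD x y M) c = (\<Sum>w\<in>open_words M c. word_prod x y w))"
  proof (induction M)
    case 0
    show ?case by (auto simp: words_0 open_words_0 word_prod_def one_pCons coeff_pCons split: nat.splits)
  next
    case (Suc M)
    have inj: "inj_on (\<lambda>(i, j). (M # i, j)) S" "inj_on (\<lambda>(i, j). (i, M # j)) S" 
      for S :: "(nat list \<times> nat list) set"
      by (auto simp: inj_on_def)
    have 1: "words M c \<inter> (\<lambda>(i, j). (M # i, j)) ` open_words M c = {}" for c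
      by (auto simp: words_altdef)
    have 2: "(\<lambda>(i, j). (i, M # j)) ` words M c \<inter> open_words M c = {}" for c
      using open_words_hd by fastforce
    have A: "coeff (fwdA x y (Suc M)) c = (\<Sum>w\<in>words (Suc M) c. word_prod x y w)" for c
      unfolding words_Suc
      by (subst sum.union_disjoint[OF finite_words _ 1])
         (auto simp: finite_open_words Suc sum.reindex[OF inj(1)] sum_distrib_left word_prod_def mult_ac
           intro!: sum.cong)
    have D: "coeff (fwdD x y (Suc M)) c = (\<Sum>w\<in>open_words (Suc M) c. word_prod x y w)" for c
    proof (cases c)
      case (Suc c')
      show ?thesis unfolding Suc open_words_Suc_Suc
        by (subst sum.union_disjoint[OF _ finite_open_words 2])
           (auto simp: finite_words \<open>_ \<and> _\<close> sum.reindex[OF inj(2)] sum_distrib_left word_prod_def mult_ac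
             intro!: sum.cong)
    qed (simp add: open_words_Suc_0)
    show ?case using A D by blast
  qed
  thus "coeff (fwdA x y M) c = (\<Sum>w\<in>words M c. word_prod x y w)"
    "coeff (fwdD x y M) c = (\<Sum>w\<in>open_words M c. word_prod x y w)" by auto
qed

lemma prod_list_vars:
  "prod_list (map varX i) = mpmono (mset i, {#})" "prod_list (map varY i) = mpmono ({#}, mset i)"
  by (induction i) (auto simp: mpmono_0 varX_def varY_def mpmono_mult)

lemma hA_words: "hA M c = (\<Sum>w\<in>words M c. mpmono (mset (fst w), mset (snd w)))"
  and aA_words: "aA M c = (\<Sum>w\<in>words M c. mpmono (mset (snd w), mset (fst w)))"
  by (simp_all add: coeff_fwd_words word_prod_def prod_list_vars mpmono_mult)

text \<open>The levels at which \<alpha> occurs, that is, the letters of i and l;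
  \<open>lower\<close> collects the conjugates, from j and k. The density condition in
  \<open>C_tuples\<close> says that both have density m.\<close>

definition upper :: "'a set \<Rightarrow> 'b set \<Rightarrow> ('a \<Rightarrow> nat list \<times> nat list) \<times> ('b \<Rightarrow> nat list \<times> nat list) \<Rightarrow> nat multiset" where
  "upper I K FG = (\<Sum>x\<in>I. mset (fst (fst FG x))) + (\<Sum>y\<in>K. mset (snd (snd FG y)))"
definition lower :: "'a set \<Rightarrow> 'b set \<Rightarrow> ('a \<Rightarrow> nat list \<times> nat list) \<times> ('b \<Rightarrow> nat list \<times> nat list) \<Rightarrow> nat multiset" where
  "lower I K FG = (\<Sum>x\<in>I. mset (snd (fst FG x))) + (\<Sum>y\<in>K. mset (fst (snd FG y)))"

definition word_families :: "nat \<Rightarrow> 'a set \<Rightarrow> 'b set \<Rightarrow> ('a \<Rightarrow> nat) \<Rightarrow> ('b \<Rightarrow> nat) \<Rightarrow>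
    (('a \<Rightarrow> nat list \<times> nat list) \<times> ('b \<Rightarrow> nat list \<times> nat list)) set" where
  "word_families M I K \<nu> \<mu> = (\<Pi>\<^sub>E x\<in>I. words M (\<nu> x)) \<times> (\<Pi>\<^sub>E y\<in>K. words M (\<mu> y))"

lemma finite_word_families: "finite I \<Longrightarrow> finite K \<Longrightarrow> finite (word_families M I K \<nu> \<mu>)"
  by (auto simp: word_families_def intro!: finite_PiE finite_words)

lemma sum_pair: "(\<Sum>x\<in>S. (f x, g x)) = ((\<Sum>x\<in>S. f x), (\<Sum>x\<in>S. g x))"
  by (induction S rule: infinite_finite_induct) (auto simp: zero_prod_def)

lemma corr_words:
  assumes fin: "finite I" "finite K"
  shows "corr \<beta> M I K \<nu> \<mu> = (\<Sum>FG\<in>word_families M I K \<nu> \<mu>. mono_wt \<beta> (upper I K FG, lower I K FG))"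
proof -
  have "(\<Prod>x\<in>I. hA M (\<nu> x)) * (\<Prod>y\<in>K. aA M (\<mu> y)) =
    (\<Sum>F\<in>(\<Pi>\<^sub>E x\<in>I. words M (\<nu> x)). \<Prod>x\<in>I. mpmono (mset (fst (F x)), mset (snd (F x)))) *
    (\<Sum>G\<in>(\<Pi>\<^sub>E y\<in>K. words M (\<mu> y)). \<Prod>y\<in>K. mpmono (mset (snd (G y)), mset (fst (G y))))"
    unfolding hA_words aA_words using fin by (simp add: prod_sum_PiE finite_words)
  also have "\<dots> = (\<Sum>FG\<in>word_families M I K \<nu> \<mu>. mpmono (upper I K FG, lower I K FG))"
    unfolding sum_product word_families_def sum.cartesian_product
    by (intro sum.cong refl) (auto simp: prod_mpmono sum_pair mpmono_mult upper_def lower_def)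
  finally show ?thesis by (simp add: corr_def expct_sum expct_mpmono)
qed

section \<open>From word families to the sum over densities\<close>

definition wt :: "real \<Rightarrow> (nat \<Rightarrow> nat) \<Rightarrow> real" where
  "wt \<beta> m = (\<Prod>N | m N \<noteq> 0. fact (m N) / (\<Prod>a=1..m N. real N * \<beta> + real a))"

lemma mono_wt_eq: "mono_wt \<beta> (A, B) = (if A = B then wt \<beta> (count A) else 0)"
proof -
  have "{N. count A N \<noteq> 0} = set_mset A" by auto
  thus ?thesis by (simp add: mono_wt_def wt_def mom_def)
qed

lemma wt_nonneg: "\<beta> \<ge> 0 \<Longrightarrow> wt \<beta> m \<ge> 0"
  unfolding wt_def by (intro prod_nonneg ballI divide_nonneg_nonneg) auto

text \<open>Four families of sequences are zipped into two families of pairs. Every letter lies in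
  the support of m, so a bound M on the support bounds all the letters.\<close>

lemma C_count_words:
  assumes m: "\<And>N. m N \<noteq> 0 \<Longrightarrow> N < M" and fin: "finite (idx p)" "finite (idx q)"
  shows "C_count p q m = card {FG \<in> word_families M (idx p) (idx q) fst fst.
    count (upper (idx p) (idx q) FG) = m \<and> count (lower (idx p) (idx q) FG) = m}" (is "_ = card ?R")
proof -
  let ?I = "idx p" and ?K = "idx q"
  let ?f = "\<lambda>(F, G). (restrict (fst \<circ> F) ?I, restrict (snd \<circ> F) ?I, restrict (fst \<circ> G) ?K, restrict (snd \<circ> G) ?K)"
  let ?g = "\<lambda>(i, j, k, l). (\<lambda>x\<in>?I. (i x, j x), \<lambda>y\<in>?K. (k y, l y))"
  have mem: "x \<in> set xs \<longleftrightarrow> count_list xs x > 0" for x and xs :: "nat list"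
    by (simp add: count_list_0_iff neq0_conv[symmetric] del: neq0_conv)
  have cnt: "count (\<Sum>x\<in>S. mset (f x)) N = (\<Sum>x\<in>S. count_list (f x) N)" for S :: "(nat \<times> nat) set" and f and N :: nat
    by (simp add: count_sum count_mset)
  have "bij_betw ?g (C_tuples p q m) ?R"
  proof (rule bij_betwI[of _ _ _ ?f])
    show "?g \<in> C_tuples p q m \<rightarrow> ?R"
    proof
      fix t assume t: "t \<in> C_tuples p q m"
      obtain i j k l where t_eq: "t = (i, j, k, l)" by (cases t)
      have I: "\<And>x. x \<in> ?I \<Longrightarrow> interlaced (fst x) (i x) (j x)"
        and K: "\<And>y. y \<in> ?K \<Longrightarrow> interlaced (fst y) (k y) (l y)"
        and m1: "\<And>N. m N = (\<Sum>x\<in>?I. count_list (i x) N) + (\<Sum>y\<in>?K. count_list (l y) N)"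
        and m2: "\<And>N. m N = (\<Sum>x\<in>?I. count_list (j x) N) + (\<Sum>y\<in>?K. count_list (k y) N)"
        using t unfolding C_tuples_def t_eq by (force simp: fun_eq_iff)+
      have pos: "(\<Sum>x\<in>S. count_list (f x) N) \<noteq> 0" if "finite S" "x \<in> S" "N \<in> set (f x)"
        for S :: "(nat \<times> nat) set" and f x and N :: nat
        by (rule gr_implies_not_zero, rule sum_pos2[OF that(1,2)]) (use that mem[of N "f x"] in auto)
      have "N < M" if "x \<in> ?I" "N \<in> set (i x) \<or> N \<in> set (j x)" for x N
        using that m1[of N] m2[of N] pos[OF fin(1), of x N i] pos[OF fin(1), of x N j] by (intro m) auto
      moreover have "N < M" if "y \<in> ?K" "N \<in> set (k y) \<or> N \<in> set (l y)" for y N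
        using that m1[of N] m2[of N] pos[OF fin(2), of y N k] pos[OF fin(2), of y N l] by (intro m) auto
      ultimately have "?g t \<in> word_families M ?I ?K fst fst"
        using I K by (fastforce simp: t_eq word_families_def words_def)
      moreover have "count (upper ?I ?K (?g t)) = m" "count (lower ?I ?K (?g t)) = m"
        by (simp_all add: t_eq upper_def lower_def fun_eq_iff cnt m1[symmetric] m2[symmetric] cong: sum.cong)
      ultimately show "?g t \<in> ?R" by blast
    qed
    show "?f \<in> ?R \<rightarrow> C_tuples p q m"
    proof
      fix FG assume FG: "FG \<in> ?R"
      obtain F G where FG_eq: "FG = (F, G)" by (cases FG)
      have *: "\<And>x. x \<in> ?I \<Longrightarrow> interlaced (fst x) (fst (F x)) (snd (F x))"
        "\<And>y. y \<in> ?K \<Longrightarrow> interlaced (fst y) (fst (G y)) (snd (G y))"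
        using FG by (auto simp: FG_eq word_families_def words_def PiE_iff case_prod_beta)
      have "m N = (\<Sum>x\<in>?I. count_list (fst (F x)) N) + (\<Sum>y\<in>?K. count_list (snd (G y)) N)"
        and "m N = (\<Sum>x\<in>?I. count_list (snd (F x)) N) + (\<Sum>y\<in>?K. count_list (fst (G y)) N)" for N
        using FG by (auto simp: FG_eq upper_def lower_def fun_eq_iff cnt)
      thus "?f FG \<in> C_tuples p q m"
        using * by (auto simp: FG_eq C_tuples_def fun_eq_iff cong: sum.cong)
    qed
    fix t assume "t \<in> C_tuples p q m"
    thus "?f (?g t) = t" by (auto simp: C_tuples_def fun_eq_iff extensional_def)
  next
    fix FG assume "FG \<in> ?R"
    thus "?g (?f FG) = FG"
      by (auto simp: word_families_def fun_eq_iff PiE_iff extensional_def)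
  qed
  thus ?thesis unfolding C_count_def by (rule bij_betw_same_card)
qed

lemma finite_idx:
  assumes "multi_index p"
  shows "finite (idx p)"
proof (rule finite_subset)
  show "idx p \<subseteq> (SIGMA n:{n. p n \<noteq> 0}. {1..p n})" by (auto simp: idx_def)
  show "finite (SIGMA n:{n. p n \<noteq> 0}. {1..p n})" using assms by (auto simp: multi_index_def)
qed

lemma sum_idx:
  assumes "multi_index p"
  shows "sum fst (idx p) = mi_deg p"
proof -
  have "n \<ge> 1" if "1 \<le> r" "r \<le> p n" for n r
    using that assms by (cases n) (auto simp: multi_index_def)
  hence "idx p = (SIGMA n:{n. p n \<noteq> 0}. {1..p n})"
    by (auto simp: idx_def)
  hence "sum fst (idx p) = (\<Sum>(n, r)\<in>(SIGMA n:{n. p n \<noteq> 0}. {1..p n}). n)"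
    by (simp only: case_prod_unfold)
  also have "\<dots> = (\<Sum>n | p n \<noteq> 0. \<Sum>r\<in>{1..p n}. n)"
    using assms by (intro sum.Sigma[symmetric]) (auto simp: multi_index_def)
  finally show ?thesis by (simp add: mi_deg_def mult.commute)
qed

text \<open>The terms are nonnegative, so the sum is the supremum of its finite partial sums. Those
  over the upper densities \<open>D M\<close> of the level-M families are the correlations, which
  increase to the limit.\<close>

lemma C_count_has_sum:
  assumes p: "multi_index p" and q: "multi_index q" and \<beta>: "\<beta> > 0"
    and deg: "d = mi_deg p" "d = mi_deg q"
  shows "((\<lambda>m. real (C_count p q m) * wt \<beta> m) has_sum hpair \<beta> d (idx p) (idx q) fst fst) {m. multi_index0 m}"
proof -
  let ?I = "idx p" and ?K = "idx q"
  let ?f = "\<lambda>m. real (C_count p q m) * wt \<beta> m"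
  let ?A = "{m. multi_index0 m}"
  let ?R = "hpair \<beta> d ?I ?K fst fst"
  note fin = finite_idx[OF p] finite_idx[OF q]
  define W where "W M = word_families M ?I ?K fst fst" for M
  define D where "D M = (\<lambda>FG. count (upper ?I ?K FG)) ` W M" for M
  have finW: "finite (W M)" for M unfolding W_def by (rule finite_word_families[OF fin])
  have finD: "finite (D M)" for M unfolding D_def using finW by simp
  have less: "N < M" if m: "m \<in> D M" and N: "m N \<noteq> 0" for m M N
  proof -
    obtain FG where FG: "FG \<in> W M" "m = count (upper ?I ?K FG)" using m by (auto simp: D_def)
    from N have "N \<in># upper ?I ?K FG" using FG by (simp add: not_in_iff[symmetric])
    hence "(\<exists>x\<in>?I. N \<in> set (fst (fst FG x))) \<or> (\<exists>y\<in>?K. N \<in> set (snd (snd FG y)))"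
      using fin by (auto simp: upper_def set_mset_sum)
    thus ?thesis using FG(1) unfolding W_def word_families_def words_def by (fastforce simp: PiE_iff)
  qed
  have cc: "C_count p q m = card {FG \<in> W M. count (upper ?I ?K FG) = m \<and> count (lower ?I ?K FG) = m}"
    if "\<And>N. m N \<noteq> 0 \<Longrightarrow> N < M" for m M
    unfolding W_def by (rule C_count_words[OF that fin])
  have sum_D: "sum ?f (D M) = corr \<beta> M ?I ?K fst fst" for M
  proof -
    have "sum ?f (D M) = (\<Sum>m\<in>D M. \<Sum>FG | FG \<in> W M \<and> count (upper ?I ?K FG) = m. mono_wt \<beta> (upper ?I ?K FG, lower ?I ?K FG))"
    proof (rule sum.cong[OF refl])
      fix m assume m: "m \<in> D M"
      \<comment> \<open>Unbalanced families have weight zero, so the fibre over m contributes its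
        number of balanced families times \<open>wt \<beta> m\<close>.\<close>
      have "(\<Sum>FG | FG \<in> W M \<and> count (upper ?I ?K FG) = m. mono_wt \<beta> (upper ?I ?K FG, lower ?I ?K FG)) =
         (\<Sum>FG | FG \<in> W M \<and> count (upper ?I ?K FG) = m \<and> count (lower ?I ?K FG) = m. wt \<beta> m)"
        using finW by (intro sum.mono_neutral_cong_right) (auto simp: mono_wt_eq multiset_eq_iff)
      also have "\<dots> = ?f m" using cc[OF less[OF m]] by simp
      finally show "?f m = (\<Sum>FG | FG \<in> W M \<and> count (upper ?I ?K FG) = m. mono_wt \<beta> (upper ?I ?K FG, lower ?I ?K FG))" ..
    qed
    also have "\<dots> = (\<Sum>FG\<in>W M. mono_wt \<beta> (upper ?I ?K FG, lower ?I ?K FG))"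
      unfolding D_def by (rule sum.image_gen[symmetric, OF finW])
    finally show ?thesis unfolding W_def corr_words[OF fin] .
  qed
  have f_nonneg: "?f m \<ge> 0" for m using \<beta> by (simp add: wt_nonneg)
  have zero: "?f m = 0" if "\<And>N. m N \<noteq> 0 \<Longrightarrow> N < M" "m \<notin> D M" for m M
  proof -
    have *: "{FG \<in> W M. count (upper ?I ?K FG) = m \<and> count (lower ?I ?K FG) = m} = {}"
      using that(2) by (auto simp: D_def)
    show ?thesis using cc[of m M, OF that(1)] * by simp
  qed
  have lim: "(\<lambda>M. corr \<beta> M ?I ?K fst fst) \<longlonglongrightarrow> ?R"
    by (rule corr_tendsto[OF \<beta> fin]) (use deg p q sum_idx in auto)
  have bound: "sum ?f F \<le> ?R" if F: "finite F" "F \<subseteq> ?A" for F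
  proof -
    \<comment> \<open>Finitely many finite supports have a common bound M, and members of
      \<open>F\<close> outside \<open>D M\<close> contribute zero.\<close>
    have "finite (\<Union>m\<in>F. {N. m N \<noteq> 0})" using F by (auto simp: multi_index0_def)
    then obtain M where M: "\<And>m N. m \<in> F \<Longrightarrow> m N \<noteq> 0 \<Longrightarrow> N < M"
      using finite_nat_bounded[of "\<Union>m\<in>F. {N. m N \<noteq> 0}"] by blast
    have "?f m = 0" if "m \<in> F - F \<inter> D M" for m
      by (rule zero[of m M]) (use M that in auto)
    hence "sum ?f F = sum ?f (F \<inter> D M)"
      using F by (intro sum.mono_neutral_right) auto
    also have "\<dots> \<le> sum ?f (D M)" using finD f_nonneg by (intro sum_mono2) auto
    also have "\<dots> \<le> ?R" unfolding sum_D
      by (rule incseq_le[OF incseq_corr[OF _ fin] lim]) (use \<beta> in auto)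
    finally show ?thesis .
  qed
  let ?S = "SUP F\<in>{F. finite F \<and> F \<subseteq> ?A}. sum ?f F"
  have bdd: "bdd_above (sum ?f ` {F. finite F \<and> F \<subseteq> ?A})" using bound by (intro bdd_aboveI[of _ ?R]) auto
  have "(?f has_sum ?S) ?A"
    using bdd by (intro nonneg_bdd_above_has_sum f_nonneg) (simp add: conj_commute)
  moreover have "?S = ?R"
  proof (rule antisym)
    show "?S \<le> ?R" using bound by (intro cSUP_least) auto
    have "corr \<beta> M ?I ?K fst fst \<le> ?S" for M
    proof -
      have "m \<in> ?A" if "m \<in> D M" for m
        using finite_subset[of "{N. m N \<noteq> 0}" "{..<M}"] less[OF that] by (auto simp: multi_index0_def)
      thus ?thesis unfolding sum_D[symmetric] using finD by (intro cSUP_upper[OF _ bdd]) auto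
    qed
    thus "?R \<le> ?S" by (intro LIMSEQ_le_const2[OF lim]) auto
  qed
  ultimately show ?thesis by simp
qed

section \<open>The function f and the polynomial in the inverse of \<beta>\<close>

lemma mi_f_hcoeff:
  assumes p: "multi_index p" and L: "multi_index L"
  shows "mi_f p L = centralizer L * hcoeff (idx p) fst L"
proof -
  have fam: "f_families p L = families (idx p) fst L"
    by (simp add: f_families_def families_def partitions_def case_prod_unfold)
  note fin = finite_idx[OF p]
  let ?S = "{u. L u \<noteq> 0}"
  have finS: "finite ?S" using L by (simp add: multi_index_def)
  have "(\<Prod>u\<in>?S. fact (L u) / (\<Prod>x\<in>idx p. fact (J x u))) =
     centralizer L * (\<Prod>x\<in>idx p. 1 / centralizer (J x))" if J: "J \<in> families (idx p) fst L" for J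
  proof -
    have sub: "{u. J x u \<noteq> 0} \<subseteq> ?S" if "x \<in> idx p" for x
      using families_sum[OF J] fin that by auto
    have L0: "u \<noteq> 0" if "u \<in> ?S" for u using L that by (cases u) (auto simp: multi_index_def)
    have "(\<Prod>x\<in>idx p. 1 / centralizer (J x)) = (\<Prod>x\<in>idx p. \<Prod>u\<in>?S. 1 / (fact (J x u) * real u ^ J x u))"
      by (intro prod.cong refl) (simp add: centralizer_superset[OF finS sub] prod_dividef)
    also have "\<dots> = (\<Prod>u\<in>?S. \<Prod>x\<in>idx p. 1 / (fact (J x u) * real u ^ J x u))"
      by (rule prod.swap)
    \<comment> \<open>For each u the exponents \<open>J x u\<close> add up to \<open>L u\<close>, so
      the powers of u will cancel against those in the centralizer of L.\<close>
    also have "\<dots> = (\<Prod>u\<in>?S. 1 / ((\<Prod>x\<in>idx p. fact (J x u)) * real u ^ L u))"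
      by (intro prod.cong refl)
         (simp add: prod_dividef prod.distrib power_sum[symmetric] families_sum[OF J, symmetric])
    finally have "centralizer L * (\<Prod>x\<in>idx p. 1 / centralizer (J x)) =
       (\<Prod>u\<in>?S. (fact (L u) * real u ^ L u) * (1 / ((\<Prod>x\<in>idx p. fact (J x u)) * real u ^ L u)))"
      by (simp only: centralizer_def prod.distrib)
    also have "\<dots> = (\<Prod>u\<in>?S. fact (L u) / (\<Prod>x\<in>idx p. fact (J x u)))"
      by (intro prod.cong refl) (use L0 in simp)
    finally show ?thesis ..
  qed
  thus ?thesis unfolding mi_f_def hcoeff_def fam sum_distrib_left by (rule sum.cong[OF refl])
qed

lemma mi_f_nonneg: "mi_f p L \<ge> 0"
  unfolding mi_f_def by (intro sum_nonneg prod_nonneg ballI divide_nonneg_nonneg) (auto intro: prod_nonneg)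

text \<open>Partitions of every n into ones form an admissible family and all summands are positive.
  This makes the coefficient of degree d of the final polynomial nonzero.\<close>

lemma mi_f_all_ones_pos:
  assumes p: "multi_index p"
  shows "mi_f p ((\<lambda>_. 0)(1 := mi_deg p)) > 0"
proof -
  note fin = finite_idx[OF p]
  let ?o = "\<lambda>n::nat. (\<lambda>_::nat. 0::nat)(1 := n)"
  have o: "?o n \<in> partitions n" for n
  proof -
    have "finite {j. (?o n) j \<noteq> 0}" by (rule finite_subset[of _ "{1}"]) auto
    moreover have "mi_deg (?o n) = n" by (subst mi_deg_superset[of "{1}"]) auto
    ultimately show ?thesis by (simp add: partitions_def multi_index_def)
  qed
  define J where "J = (\<lambda>x\<in>idx p. ?o (fst x))"
  have "J \<in> families (idx p) fst (?o (mi_deg p))"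
    using o sum_idx[OF p] by (auto simp: families_def J_def fun_eq_iff)
  moreover have "(\<Prod>x\<in>idx p. 1 / centralizer (J x)) > 0" if "J \<in> families (idx p) fst L" for J :: "nat \<times> nat \<Rightarrow> nat \<Rightarrow> nat" and L
    using that by (intro prod_pos ballI) (auto simp: families_def intro!: centralizer_pos)
  ultimately have "hcoeff (idx p) fst (?o (mi_deg p)) > 0"
    unfolding hcoeff_def using finite_families[OF fin]
    by (intro sum_pos) auto
  thus ?thesis
    using o[of "mi_deg p"] centralizer_pos[OF o[of "mi_deg p"]]
    by (subst mi_f_hcoeff[OF p]) (auto simp: partitions_def)
qed

lemma mi_size_le_deg: "multi_index L \<Longrightarrow> mi_size L \<le> mi_deg L"
  unfolding mi_size_def mi_deg_def by (intro sum_mono) (auto simp: multi_index_def Suc_le_eq intro: gr0I)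

theorem theorem6p2:
  fixes p q :: "nat \<Rightarrow> nat" and d :: nat
  assumes "multi_index p" and "multi_index q"
    and "d = mi_deg p" and "d = mi_deg q"
  shows "(\<forall>\<beta>::real. \<beta> > 0 \<longrightarrow>
           ((\<lambda>m. real (C_count p q m) *
                 (\<Prod>N | m N \<noteq> 0. fact (m N) / (\<Prod>a=1..m N. real N * \<beta> + real a)))
            has_sum measure_pmf.expectation (partition_pmf d)
                      (\<lambda>L. mi_f p L * mi_f q L * \<beta> powi (- int (mi_size L))))
           {m. multi_index0 m}) \<and>
         (\<exists>P :: real poly. degree P = d \<and>
           (\<forall>\<beta>::real. \<beta> > 0 \<longrightarrow>
              measure_pmf.expectation (partition_pmf d)
                (\<lambda>L. mi_f p L * mi_f q L * \<beta> powi (- int (mi_size L))) = poly P (inverse \<beta>)))"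
proof (intro conjI allI impI)
  fix \<beta> :: real assume \<beta>: "\<beta> > 0"
  have "measure_pmf.expectation (partition_pmf d) (\<lambda>L. mi_f p L * mi_f q L * \<beta> powi (- int (mi_size L))) =
     hpair \<beta> d (idx p) (idx q) fst fst"
    unfolding expectation_partition_pmf hpair_def
  proof (rule sum.cong[OF refl])
    fix L assume L: "L \<in> partitions d"
    hence "multi_index L" by (simp add: partitions_def)
    \<comment> \<open>Each \<open>mi_f\<close> brings a factor \<open>centralizer L\<close> and the
      probability of L removes one, leaving the square norm in \<open>hpair\<close>.\<close>
    thus "mi_f p L * mi_f q L * \<beta> powi (- int (mi_size L)) / centralizer L =
        hcoeff (idx p) fst L * hcoeff (idx q) fst L * centralizer L / \<beta> ^ mi_size L"
      using centralizer_pos[OF L]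
      by (simp add: mi_f_hcoeff assms power_int_minus field_simps)
  qed
  thus "((\<lambda>m. real (C_count p q m) *
                 (\<Prod>N | m N \<noteq> 0. fact (m N) / (\<Prod>a=1..m N. real N * \<beta> + real a)))
            has_sum measure_pmf.expectation (partition_pmf d)
                      (\<lambda>L. mi_f p L * mi_f q L * \<beta> powi (- int (mi_size L))))
           {m. multi_index0 m}"
    using C_count_has_sum[OF assms(1,2) \<beta> assms(3,4)] by (simp add: wt_def)
next
  \<comment> \<open>The exponent of the inverse of \<beta> is the number of parts, at most d, and
    the partition \<open>?o\<close> into ones attains d with a positive coefficient.\<close>
  define c where "c L = mi_f p L * mi_f q L / centralizer L" for L
  define P where "P = (\<Sum>L\<in>partitions d. monom (c L) (mi_size L))"
  have c_nonneg: "c L \<ge> 0" if "L \<in> partitions d" for L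
    unfolding c_def using centralizer_pos[OF that] by (simp add: mi_f_nonneg)
  have size: "mi_size L \<le> d" if "L \<in> partitions d" for L
    using mi_size_le_deg[of L] that by (simp add: partitions_def)
  let ?o = "(\<lambda>_::nat. 0::nat)(1 := d)"
  have o: "?o \<in> partitions d"
  proof -
    have "finite {j. ?o j \<noteq> 0}" by (rule finite_subset[of _ "{1}"]) auto
    moreover have "mi_deg ?o = d" by (subst mi_deg_superset[of "{1}"]) auto
    ultimately show ?thesis by (simp add: partitions_def multi_index_def)
  qed
  have "c ?o > 0"
    unfolding c_def using mi_f_all_ones_pos[OF assms(1)] mi_f_all_ones_pos[OF assms(2)]
      centralizer_pos[OF o] assms(3,4) by simp
  moreover have "mi_size ?o = d" by (subst mi_size_superset[of "{1}"]) auto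
  ultimately have "coeff P d > 0"
    unfolding P_def coeff_sum
    by (intro sum_pos2[OF finite_partitions o]) (auto simp: c_nonneg)
  moreover have "degree P \<le> d"
    unfolding P_def by (intro degree_sum_le finite_partitions order_trans[OF degree_monom_le] size)
  ultimately have "degree P = d" by (intro antisym le_degree) auto
  moreover have "measure_pmf.expectation (partition_pmf d)
       (\<lambda>L. mi_f p L * mi_f q L * \<beta> powi (- int (mi_size L))) = poly P (inverse \<beta>)" for \<beta> :: real
    unfolding expectation_partition_pmf P_def poly_sum poly_monom
    by (intro sum.cong refl) (simp add: c_def power_int_minus power_inverse)
  ultimately show "\<exists>P :: real poly. degree P = d \<and>
           (\<forall>\<beta>::real. \<beta> > 0 \<longrightarrow>
              measure_pmf.expectation (partition_pmf d)
                (\<lambda>L. mi_f p L * mi_f q L * \<beta> powi (- int (mi_size L))) = poly P (inverse \<beta>))"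
    by blast
qed

end
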